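(* Consider a continuous-time irreducible Markov chain with finite state space $\mathcal{X}=\{0,1,\dots,d\}$, generator $Q$ and stationary distribution $\pi$. (i) The Markov chain is time-reversible if and only if there exists a Riemannian metric $g$ of class $C^1$ on $\mathcal{P}$ such that the flow associated to the semigroup $e^{tQ}$ equals the gradient flow under $g$ of the relative entropy $\mathfrak{H}$ with respect to the stationary distribution $\pi$. (ii) The Markov chain has a real diagonalisable generator $Q$ if and only if there exist a Riemannian metric $g$ of class $C^1$ on $\mathcal{P}$ and a functional $\mathfrak{F}:\mathcal{P}\to\mathbb{R}$ of class $C^2$ such that the flow associated to the semigroup $e^{tQ}$ is the gradient flow of $\mathfrak{F}$ under $g$.
   Context: State space: $\mathcal{X}=\{0,1,\dots,d\}$. A generator is a matrix $Q\in\mathbb{R}^{\mathcal{X}\times\mathcal{X}}$ where for $i\neq j$ the entry $Q_{ij}\ge 0$ is the transition rate from $i$ to $j$, and $Q_{ii}=-\sum_{j\neq i}Q_{ij}$. Probability distributions are row vectors and matrices act on them from the right: with initial law $\mu$ the law at time $t$ is $\mu e^{tQ}$. An irreducible chain has a unique stationary distribution $\pi$ ($\pi Q=0$), which has positive mass at every state. The chain is time-reversible if it satisfies detailed balance $\pi_iQ_{ij}=\pi_jQ_{ji}$ for all $i,j\in\mathcal{X}$. $Q$ is real diagonalisable if it is diagonalisable over $\mathbb{R}$. $\mathcal{P}$ is the set of probability distributions on $\mathcal{X}$ with positive mass at every state, viewed as the $d$-dimensional submanifold $\{v\in\mathbb{R}^{\mathcal{X}}:\sum_{i}v_i=1,\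 v_i>0\ \forall i\}$ of $\mathbb{R}^{\mathcal{X}}$. Its tangent space at any point is identified with $T=\{v\in\mathbb{R}^{\mathcal{X}}:\sum_{i}v_i=0\}$. A Riemannian metric $g$ on $\mathcal{P}$ assigns to each $\mu\in\mathcal{P}$ an inner product $g|_\mu$ on $T$; it is of class $C^1$ if $\mu\mapsto g|_\mu(v,w)$ is $C^1$ for all $v,w\in T$. Given a functional $\mathfrak{F}:\mathcal{P}\to\mathbb{R}$ and a Riemannian metric $g$, a gradient flow $\rho:[0,\infty)\to\mathcal{P}$ of $\mathfrak{F}$ under $g$ is determined by $g|_{\rho(t)}(\dot\rho(t),v)=-\mathrm{d}\mathfrak{F}|_{\rho(t)}(v)$ for all $v\in T$ and $t\ge 0$. The gradient flow of $\mathfrak{F}$ under $g$ equals the flow associated to the semigroup $e^{tQ}$ if for every $\mu\in\mathcal{P}$ the trajectory $t\mapsto\mu e^{tQ}$ is the gradient flow $\rho(t)$ with $\rho(0)=\mu$. The relative entropy with respect to $\pi$ is $\mathfrak{H}(\rho)=-\sum_{i\in\mathcal{X}}\rho_i\log\frac{\pi_i}{\rho_i}$ for $\rho\in\mathcal{P}$. *)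

theory Defs
  imports "HOL-Analysis.Analysis"
begin

text \<open>The state space \<open>{0, \<dots>, d}\<close> is an arbitrary finite index type \<open>'n\<close> with \<open>d + 1\<close> elements.\<close>

definition generator :: "real^'n^'n \<Rightarrow> bool" where
  "generator Q \<longleftrightarrow>
     (\<forall>i j. i \<noteq> j \<longrightarrow> Q $ i $ j \<ge> 0) \<and> (\<forall>i. Q $ i $ i = - (\<Sum>j\<in>UNIV - {i}. Q $ i $ j))"

definition irreducible_chain :: "real^'n^'n \<Rightarrow> bool" where
  "irreducible_chain Q \<longleftrightarrow> (\<forall>i j. (i, j) \<in> {(k, l). k \<noteq> l \<and> Q $ k $ l > 0}\<^sup>*)"

definition stationary_distribution :: "real^'n^'n \<Rightarrow> real^'n \<Rightarrow> bool" where
  "stationary_distribution Q \<pi> \<longleftrightarrow> (\<forall>i. \<pi> $ i \<ge> 0) \<and> (\<Sum>i\<in>UNIV. \<pi> $ i) = 1 \<and> \<pi> v* Q = 0"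

definition time_reversible :: "real^'n^'n \<Rightarrow> real^'n \<Rightarrow> bool" where
  "time_reversible Q \<pi> \<longleftrightarrow> (\<forall>i j. \<pi> $ i * Q $ i $ j = \<pi> $ j * Q $ j $ i)"

definition real_diagonalisable :: "real^'n^'n \<Rightarrow> bool" where
  "real_diagonalisable Q \<longleftrightarrow>
     (\<exists>S D :: real^'n^'n. invertible S \<and> (\<forall>i j. i \<noteq> j \<longrightarrow> D $ i $ j = 0) \<and> Q = S ** D ** matrix_inv S)"

text \<open>The type \<open>real^'n^'n\<close> carries the componentwise product, so neither \<open>exp\<close> nor \<open>A ^ k\<close> is
  available for the matrix product.\<close>

definition matrix_exp :: "real^'n^'n \<Rightarrow> real^'n^'n" where
  "matrix_exp A = (\<Sum>k. (1 / fact k) *\<^sub>R (((**) A ^^ k) (mat 1)))"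

lemma summable_matrix_exp:
  fixes A :: "real^'n^'n"
  shows "summable (\<lambda>k. (1 / fact k) *\<^sub>R (((**) A ^^ k) (mat 1)))"
proof -
  have "linear (\<lambda>X :: real^'n^'n. A ** X)"
    by (rule linearI) (simp_all add: matrix_add_ldistrib matrix_scalar_ac scalar_matrix_assoc
        matrix_matrix_mult_def vec_eq_iff sum_distrib_left sum.distrib algebra_simps)
  then obtain K where K: "K > 0" "\<And>X :: real^'n^'n. norm (A ** X) \<le> K * norm X"
    using linear_bounded_pos by blast
  have pow: "norm (((**) A ^^ k) (mat 1)) \<le> K ^ k * norm (mat 1 :: real^'n^'n)" for k
  proof (induction k)
    case (Suc k)
    have "norm (((**) A ^^ Suc k) (mat 1)) \<le> K * norm (((**) A ^^ k) (mat 1))"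
      using K(2) by simp
    also have "\<dots> \<le> K * (K ^ k * norm (mat 1 :: real^'n^'n))"
      using Suc K(1) by (intro mult_left_mono) auto
    finally show ?case by (simp add: mult.assoc)
  qed simp
  have "summable (\<lambda>k. (inverse (fact k) * K ^ k) * norm (mat 1 :: real^'n^'n))"
    by (intro summable_mult2 summable_exp)
  then show ?thesis
  proof (rule summable_comparison_test'[where N = 0])
    fix k :: nat
    show "norm ((1 / fact k) *\<^sub>R ((**) A ^^ k) (mat 1))
            \<le> inverse (fact k) * K ^ k * norm (mat 1 :: real^'n^'n)"
      using mult_left_mono[OF pow[of k], of "inverse (fact k)"]
      by (simp add: divide_inverse mult.assoc)
  qed
qed

definition pos_dists :: "(real^'n) set" where
  "pos_dists = {\<mu>. (\<Sum>i\<in>UNIV. \<mu> $ i) = 1 \<and> (\<forall>i. \<mu> $ i > 0)}"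

definition tangent :: "(real^'n) set" where
  "tangent = {v. (\<Sum>i\<in>UNIV. v $ i) = 0}"

text \<open>A function on \<open>pos_dists\<close> is a function on \<open>real^'n\<close> whose values elsewhere are irrelevant.
  Its differential is the derivative within \<open>pos_dists\<close>; this is a linear map on \<open>real^'n\<close> of which
  only the restriction to \<open>tangent\<close> is determined (see \<open>differential_eq\<close> below), so that
  \<open>differential f \<mu> v\<close> may only be used for \<open>v \<in> tangent\<close>.\<close>

definition differential :: "(real^'n \<Rightarrow> real) \<Rightarrow> real^'n \<Rightarrow> real^'n \<Rightarrow> real" where
  "differential f \<mu> = frechet_derivative f (at \<mu> within pos_dists)"

primrec C_k :: "nat \<Rightarrow> (real^'n \<Rightarrow> real) \<Rightarrow> bool" where
  "C_k 0 f \<longleftrightarrow> continuous_on pos_dists f"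
| "C_k (Suc k) f \<longleftrightarrow>
     f differentiable_on pos_dists \<and> (\<forall>v\<in>tangent. C_k k (\<lambda>\<mu>. differential f \<mu> v))"

lemma differential_eq:
  fixes f :: "real^'n \<Rightarrow> real"
  assumes D: "(f has_derivative D) (at \<mu> within pos_dists)"
    and \<mu>: "\<mu> \<in> pos_dists" and v: "v \<in> tangent"
  shows "differential f \<mu> v = D v"
proof -
  have "\<forall>i\<in>UNIV. eventually (\<lambda>s. \<mu> $ i + s * v $ i > 0) (at (0::real))"
  proof
    fix i
    have "((\<lambda>s. \<mu> $ i + s * v $ i) \<longlongrightarrow> \<mu> $ i + 0 * v $ i) (at (0::real))"
      by (intro tendsto_intros)
    moreover have "\<mu> $ i > 0" using \<mu> by (simp add: pos_dists_def)
    ultimately show "eventually (\<lambda>s. \<mu> $ i + s * v $ i > 0) (at (0::real))"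
      by (intro order_tendstoD(1)) auto
  qed
  then have "eventually (\<lambda>s. \<forall>i\<in>UNIV. \<mu> $ i + s * v $ i > 0) (at (0::real))"
    by (rule eventually_ball_finite[OF finite])
  then obtain e where e: "e > 0" "\<And>s. s \<noteq> 0 \<Longrightarrow> dist s 0 < e \<Longrightarrow> \<forall>i. \<mu> $ i + s * v $ i > 0"
    unfolding eventually_at by auto
  have line: "(\<lambda>s. \<mu> + s *\<^sub>R v) ` ball (0::real) e \<subseteq> pos_dists"
  proof (clarify)
    fix s :: real assume s: "s \<in> ball 0 e"
    have "(\<Sum>i\<in>UNIV. (\<mu> + s *\<^sub>R v) $ i) = 1"
      using \<mu> v by (simp add: pos_dists_def tangent_def sum.distrib flip: sum_distrib_left)
    moreover have "\<forall>i. \<mu> $ i + s * v $ i > 0"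
      using e(2)[of s] s \<mu> by (cases "s = 0") (auto simp: pos_dists_def dist_commute)
    ultimately show "\<mu> + s *\<^sub>R v \<in> pos_dists" by (simp add: pos_dists_def)
  qed
  have along: "((\<lambda>s. f (\<mu> + s *\<^sub>R v)) has_real_derivative E v) (at (0::real))"
    if E: "(f has_derivative E) (at \<mu> within pos_dists)" for E
  proof -
    have "((\<lambda>s. \<mu> + s *\<^sub>R v) has_derivative (\<lambda>s. s *\<^sub>R v)) (at (0::real) within ball 0 e)"
      by (auto intro!: derivative_eq_intros)
    moreover have "(f has_derivative E)
        (at (\<mu> + (0::real) *\<^sub>R v) within (\<lambda>s. \<mu> + s *\<^sub>R v) ` ball (0::real) e)"
      using has_derivative_subset[OF E line] by simp
    ultimately have "(f \<circ> (\<lambda>s. \<mu> + s *\<^sub>R v) has_derivative E \<circ> (\<lambda>s. s *\<^sub>R v))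
        (at (0::real) within ball 0 e)"
      by (rule diff_chain_within)
    moreover have "E \<circ> (\<lambda>s. s *\<^sub>R v) = (*) (E v)"
      using linear_scale[OF has_derivative_linear[OF E]] by (auto simp: fun_eq_iff)
    ultimately show ?thesis
      using e(1) by (simp add: has_field_derivative_def o_def at_within_open[of 0 "ball 0 e"])
  qed
  have "f differentiable (at \<mu> within pos_dists)" using D by (auto simp: differentiable_def)
  then have "(f has_derivative differential f \<mu>) (at \<mu> within pos_dists)"
    by (simp add: differential_def frechet_derivative_works)
  from DERIV_unique[OF along[OF this] along[OF D]] show ?thesis .
qed

definition inner_product_on_tangent :: "(real^'n \<Rightarrow> real^'n \<Rightarrow> real) \<Rightarrow> bool" where
  "inner_product_on_tangent b \<longleftrightarrow>
     (\<forall>u\<in>tangent. \<forall>v\<in>tangent. \<forall>w\<in>tangent. b (u + v) w = b u w + b v w) \<and>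
     (\<forall>c. \<forall>u\<in>tangent. \<forall>v\<in>tangent. b (c *\<^sub>R u) v = c * b u v) \<and>
     (\<forall>u\<in>tangent. \<forall>v\<in>tangent. b u v = b v u) \<and>
     (\<forall>u\<in>tangent. u \<noteq> 0 \<longrightarrow> b u u > 0)"

definition C1_riemannian_metric :: "(real^'n \<Rightarrow> real^'n \<Rightarrow> real^'n \<Rightarrow> real) \<Rightarrow> bool" where
  "C1_riemannian_metric g \<longleftrightarrow>
     (\<forall>\<mu>\<in>pos_dists. inner_product_on_tangent (g \<mu>)) \<and>
     (\<forall>v\<in>tangent. \<forall>w\<in>tangent. C_k 1 (\<lambda>\<mu>. g \<mu> v w))"

definition gradient_flow ::
    "(real^'n \<Rightarrow> real) \<Rightarrow> (real^'n \<Rightarrow> real^'n \<Rightarrow> real^'n \<Rightarrow> real) \<Rightarrow> (real \<Rightarrow> real^'n) \<Rightarrow> bool" where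
  "gradient_flow F g \<rho> \<longleftrightarrow>
     (\<forall>t\<ge>0. \<rho> t \<in> pos_dists \<and> F differentiable (at (\<rho> t) within pos_dists) \<and>
       (\<exists>r. (\<rho> has_vector_derivative r) (at t within {0..}) \<and>
            (\<forall>v\<in>tangent. g (\<rho> t) r v = - differential F (\<rho> t) v)))"

definition semigroup_is_gradient_flow ::
    "real^'n^'n \<Rightarrow> (real^'n \<Rightarrow> real) \<Rightarrow> (real^'n \<Rightarrow> real^'n \<Rightarrow> real^'n \<Rightarrow> real) \<Rightarrow> bool" where
  "semigroup_is_gradient_flow Q F g \<longleftrightarrow>
     (\<forall>\<mu>\<in>pos_dists. gradient_flow F g (\<lambda>t. \<mu> v* matrix_exp (t *\<^sub>R Q)))"

definition relative_entropy :: "real^'n \<Rightarrow> real^'n \<Rightarrow> real" where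
  "relative_entropy \<pi> \<rho> = - (\<Sum>i\<in>UNIV. \<rho> $ i * ln (\<pi> $ i / \<rho> $ i))"

end

theory Submission
  imports Defs
begin

text \<open>
  The semigroup maps \<open>pos_dists\<close> into itself, and every point of \<open>pos_dists\<close> is an initial value.
  Hence \<open>e\<^sup>t\<^sup>Q\<close> is the gradient flow of \<open>F\<close> under \<open>g\<close> precisely when
  \<open>g\<^sub>\<mu>(\<mu>Q, v) = - dF\<^sub>\<mu>(v)\<close> at every \<open>\<mu>\<close> and for every tangent vector \<open>v\<close>
  (\<open>semigroup_is_gradient_flow_iff\<close>); time has disappeared from the problem.

  For the necessity of the two conditions, linearise this identity at the equilibrium \<open>\<pi>\<close>. As \<open>\<pi>Q = 0\<close>,
  the right-hand side gives the Hessian of \<open>F\<close> and the left-hand side gives \<open>g\<^sub>\<pi>(xQ, y)\<close>, so symmetry of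
  the Hessian makes \<open>Q\<close> self-adjoint on the tangent space for the inner product \<open>g\<^sub>\<pi>\<close>
  (\<open>generator_selfadjoint_at_equilibrium\<close>). The Hessian is reached as a limit of second differences,
  which are visibly symmetric. The spectral theorem
  (\<open>selfadjoint_eigenvectors_span\<close>) then makes \<open>Q\<close> diagonalisable over the reals. For the
  entropy the Hessian at \<open>\<pi>\<close> is explicitly \<open>b(x, y) = \<Sum> x\<^sub>i y\<^sub>i / \<pi>\<^sub>i\<close>, so that \<open>g\<^sub>\<pi>(xQ, y) = - b(x, y)\<close>.
  Then \<open>b(xQ, y) = - g\<^sub>\<pi>(xQQ, y) = - g\<^sub>\<pi>(xQ, yQ)\<close> is symmetric in \<open>x\<close> and \<open>y\<close>, and self-adjointness
  of \<open>Q\<close> for \<open>b\<close> is detailed balance.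

  For the sufficiency in the diagonalisable case, use coordinates \<open>\<xi>\<^sub>k\<close> in which the flow is
  \<open>\<xi>\<^sub>k' = d\<^sub>k \<xi>\<^sub>k\<close>; this is the Euclidean gradient flow of \<open>- \<Sum> d\<^sub>k \<xi>\<^sub>k\<^sup>2 / 2\<close>. In the reversible case
  write \<open>\<alpha>\<^sub>i = ln (\<mu>\<^sub>i / \<pi>\<^sub>i)\<close>, which is the differential of the entropy up to constants, and put
  \<open>(K\<^sub>\<mu> a)\<^sub>i = \<Sum>\<^sub>j \<Lambda>\<^sub>i\<^sub>j \<pi>\<^sub>i Q\<^sub>i\<^sub>j (a\<^sub>i - a\<^sub>j)\<close>, where \<open>\<Lambda>\<^sub>i\<^sub>j\<close> is the logarithmic mean of \<open>\<mu>\<^sub>i / \<pi>\<^sub>i\<close> and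
  \<open>\<mu>\<^sub>j / \<pi>\<^sub>j\<close>. The logarithmic mean turns differences of logarithms into differences, whence
  \<open>K\<^sub>\<mu> \<alpha> = - \<mu>Q\<close> by detailed balance. By detailed balance and irreducibility \<open>K\<^sub>\<mu>\<close> is
  symmetric and positive definite modulo constants, and its inverse on the tangent space is the
  required metric (\<open>time_reversible_imp_entropy_gradient_flow\<close>).
\<close>

section \<open>Differentiation on the positive distributions\<close>

text \<open>The differential depends on the values on \<open>pos_dists\<close> only. This allows the differential of a
  concrete function to be replaced by an explicit formula under \<open>C_k\<close>, as is done in
  \<open>C_k_SucI\<close>.\<close>

lemma differential_cong:
  assumes "\<And>\<mu>. \<mu> \<in> pos_dists \<Longrightarrow> f \<mu> = g \<mu>" and "\<mu> \<in> pos_dists"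
  shows "differential f \<mu> = differential g \<mu>"
proof -
  have "(f has_derivative D) (at \<mu> within pos_dists)
      \<longleftrightarrow> (g has_derivative D) (at \<mu> within pos_dists)" for D
    using has_derivative_transform[of \<mu> pos_dists f g] has_derivative_transform[of \<mu> pos_dists g f] assms
    by metis
  then show ?thesis
    unfolding differential_def frechet_derivative_def by simp
qed

lemma C_k_cong:
  assumes "\<And>\<mu>. \<mu> \<in> pos_dists \<Longrightarrow> f \<mu> = g \<mu>"
  shows "C_k k f \<longleftrightarrow> C_k k g"
  using assms
proof (induction k arbitrary: f g)
  case 0
  then show ?case by (auto cong: continuous_on_cong)
next
  case (Suc k)
  have "f differentiable_on pos_dists \<longleftrightarrow> g differentiable_on pos_dists"
    unfolding differentiable_on_def differentiable_def
    using Suc.prems has_derivative_transform[of _ pos_dists f g] has_derivative_transform[of _ pos_dists g f]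
    by (metis (no_types, lifting))
  moreover have "C_k k (\<lambda>\<mu>. differential f \<mu> v) \<longleftrightarrow> C_k k (\<lambda>\<mu>. differential g \<mu> v)" for v
    using differential_cong[of f g] Suc.prems by (intro Suc.IH) simp
  ultimately show ?case by simp
qed

lemma C_k_SucI:
  assumes "\<And>\<mu>. \<mu> \<in> pos_dists \<Longrightarrow> (f has_derivative D \<mu>) (at \<mu> within pos_dists)"
    and "\<And>v. v \<in> tangent \<Longrightarrow> C_k k (\<lambda>\<mu>. D \<mu> v)"
  shows "C_k (Suc k) f"
proof -
  have "f differentiable_on pos_dists"
    using assms(1) by (auto simp: differentiable_on_def differentiable_def)
  moreover have "C_k k (\<lambda>\<mu>. differential f \<mu> v)" if "v \<in> tangent" for v
    using assms(2)[OF that] differential_eq[OF assms(1) _ that]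
    by (subst C_k_cong[where g = "\<lambda>\<mu>. D \<mu> v"]) auto
  ultimately show ?thesis by simp
qed

lemma C_k_differentiable:
  assumes "C_k (Suc k) f" and "\<mu> \<in> pos_dists"
  shows "(f has_derivative differential f \<mu>) (at \<mu> within pos_dists)"
  using assms by (auto simp: differentiable_on_def differential_def frechet_derivative_works)

lemma C_k_SucD: "C_k (Suc k) f \<Longrightarrow> C_k k f"
proof (induction k arbitrary: f)
  case 0
  then show ?case by (simp add: differentiable_imp_continuous_on)
next
  case (Suc k)
  then show ?case using C_k.simps(2)[of k] C_k.simps(2)[of "Suc k"] by blast
qed

lemma C_k_const: "C_k k (\<lambda>\<mu>. c)"
proof (induction k arbitrary: c)
  case (Suc k)
  show ?case by (rule C_k_SucI[where D = "\<lambda>_ _. 0"]) (auto simp: Suc)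
qed simp

lemma C_k_linear:
  fixes f :: "real^'n \<Rightarrow> real"
  assumes "linear f"
  shows "C_k k f"
proof (cases k)
  case 0
  then show ?thesis using assms by (simp add: linear_continuous_on linear_linear)
next
  case (Suc l)
  show ?thesis unfolding Suc
    by (rule C_k_SucI[where D = "\<lambda>_. f"])
      (auto intro: linear_imp_has_derivative assms C_k_const)
qed

lemma C_k_add: "C_k k f \<Longrightarrow> C_k k g \<Longrightarrow> C_k k (\<lambda>\<mu>. f \<mu> + g \<mu>)"
proof (induction k arbitrary: f g)
  case (Suc k)
  show ?case
    by (rule C_k_SucI, rule has_derivative_add; (rule C_k_differentiable)?)
      (use Suc in auto)
qed (auto intro: continuous_intros)

lemma C_k_mult: "C_k k f \<Longrightarrow> C_k k g \<Longrightarrow> C_k k (\<lambda>\<mu>. f \<mu> * g \<mu>)"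
proof (induction k arbitrary: f g)
  case (Suc k)
  show ?case
  proof (rule C_k_SucI)
    show "((\<lambda>\<mu>. f \<mu> * g \<mu>) has_derivative
        (\<lambda>v. f \<mu> * differential g \<mu> v + differential f \<mu> v * g \<mu>)) (at \<mu> within pos_dists)"
      if "\<mu> \<in> pos_dists" for \<mu>
      using Suc.prems that by (intro has_derivative_mult C_k_differentiable)
    show "C_k k (\<lambda>\<mu>. f \<mu> * differential g \<mu> v + differential f \<mu> v * g \<mu>)" if "v \<in> tangent" for v
      using Suc.prems that C_k_SucD[OF Suc.prems(1)] C_k_SucD[OF Suc.prems(2)]
      by (intro C_k_add Suc.IH) auto
  qed
qed (auto intro: continuous_intros)

lemma C_k_uminus: "C_k k f \<Longrightarrow> C_k k (\<lambda>\<mu>. - f \<mu>)"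
  using C_k_mult[OF C_k_const[of k "-1"], of f] by simp

lemma C_k_sum: "(\<And>i. i \<in> I \<Longrightarrow> C_k k (f i)) \<Longrightarrow> C_k k (\<lambda>\<mu>. \<Sum>i\<in>I. f i \<mu>)"
  by (induction I rule: infinite_finite_induct) (simp_all add: C_k_const C_k_add)

lemma C_k_prod: "(\<And>i. i \<in> I \<Longrightarrow> C_k k (f i)) \<Longrightarrow> C_k k (\<lambda>\<mu>. \<Prod>i\<in>I. f i \<mu>)"
  by (induction I rule: infinite_finite_induct) (simp_all add: C_k_const C_k_mult)

lemma C_k_det:
  fixes A :: "real^'n \<Rightarrow> real^'m^'m"
  assumes "\<And>i j. C_k k (\<lambda>\<mu>. A \<mu> $ i $ j)"
  shows "C_k k (\<lambda>\<mu>. det (A \<mu>))"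
  unfolding det_def by (rule C_k_sum, rule C_k_mult, rule C_k_const, rule C_k_prod, rule assms)

lemma C1_compose:
  fixes h :: "real \<Rightarrow> real"
  assumes f: "C_k 1 f"
    and h: "\<And>\<mu>. \<mu> \<in> pos_dists \<Longrightarrow> (h has_real_derivative h' (f \<mu>)) (at (f \<mu>))"
    and h': "\<And>\<mu>. \<mu> \<in> pos_dists \<Longrightarrow> isCont h' (f \<mu>)"
  shows "C_k 1 (\<lambda>\<mu>. h (f \<mu>))"
  unfolding One_nat_def
proof (rule C_k_SucI)
  show "((\<lambda>\<mu>. h (f \<mu>)) has_derivative (\<lambda>v. differential f \<mu> v * h' (f \<mu>)))
      (at \<mu> within pos_dists)" if "\<mu> \<in> pos_dists" for \<mu>
    using DERIV_compose_FDERIV[of h _ f, OF h[OF that] C_k_differentiable[of 0 f]] f that by simp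
  have "continuous_on pos_dists f" using C_k_SucD[of 0 f] f by simp
  then have "continuous_on pos_dists (\<lambda>\<mu>. h' (f \<mu>))"
    unfolding continuous_on_eq_continuous_within
    using continuous_within_compose3[where g = h' and f = f] h' by blast
  then show "C_k 0 (\<lambda>\<mu>. differential f \<mu> v * h' (f \<mu>))" if "v \<in> tangent" for v
    using f that by (auto intro!: continuous_intros)
qed

text \<open>Quotients occur because the metric of a reversible chain is obtained by matrix inversion, which
  Cramer's rule reduces to determinants.\<close>

lemma C1_divide:
  assumes "C_k 1 f" "C_k 1 g" and nz: "\<And>\<mu>. \<mu> \<in> pos_dists \<Longrightarrow> g \<mu> \<noteq> 0"
  shows "C_k 1 (\<lambda>\<mu>. f \<mu> / g \<mu>)"
proof -
  have "C_k 1 (\<lambda>\<mu>. inverse (g \<mu>))"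
    by (rule C1_compose[where h' = "\<lambda>x. - (inverse x)\<^sup>2", OF assms(2)])
      (auto intro!: derivative_eq_intros continuous_intros simp: nz power2_eq_square)
  then show ?thesis using C_k_mult[OF assms(1)] by (simp add: divide_inverse)
qed

lemma relative_entropy_has_derivative:
  fixes \<pi> :: "real^'n"
  assumes "\<mu> \<in> pos_dists" and "\<And>i. \<pi> $ i > 0"
  shows "(relative_entropy \<pi> has_derivative (\<lambda>v. \<Sum>i\<in>UNIV. v $ i * (ln (\<mu> $ i / \<pi> $ i) + 1)))
    (at \<mu> within pos_dists)"
proof -
  have pos: "\<mu> $ i > 0" for i using assms by (simp add: pos_dists_def)
  have "((\<lambda>x. - (x $ i * ln (\<pi> $ i / x $ i))) has_derivative
      (\<lambda>v. v $ i * (ln (\<mu> $ i / \<pi> $ i) + 1))) (at \<mu> within pos_dists)" for i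
  proof -
    have "((\<lambda>x. - (x * ln (\<pi> $ i / x))) has_real_derivative (ln (\<mu> $ i / \<pi> $ i) + 1)) (at (\<mu> $ i))"
    proof (rule DERIV_cong)
      show "((\<lambda>x. - (x * ln (\<pi> $ i / x))) has_real_derivative
          - (ln (\<pi> $ i / \<mu> $ i) + (- (\<pi> $ i) / (\<mu> $ i * \<mu> $ i)) * (1 / (\<pi> $ i / \<mu> $ i)) * \<mu> $ i))
        (at (\<mu> $ i))"
        using pos[of i] assms(2)[of i] by (auto intro!: derivative_eq_intros)
    qed (use pos[of i] assms(2)[of i] in \<open>simp add: ln_div\<close>)
    from DERIV_compose_FDERIV[where g = "\<lambda>x. x $ i", OF this
        bounded_linear_imp_has_derivative[OF bounded_linear_vec_nth]]
    show ?thesis .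
  qed
  then have "((\<lambda>x. \<Sum>i\<in>UNIV. - (x $ i * ln (\<pi> $ i / x $ i))) has_derivative
      (\<lambda>v. \<Sum>i\<in>UNIV. v $ i * (ln (\<mu> $ i / \<pi> $ i) + 1))) (at \<mu> within pos_dists)"
    by (intro has_derivative_sum)
  then show ?thesis
    by (simp add: relative_entropy_def[abs_def] sum_negf)
qed

section \<open>The Markov semigroup\<close>

lemma vector_matrix_mult_component: "(x v* A) $ j = (\<Sum>i\<in>UNIV. x $ i * A $ i $ j)"
  by (simp add: vector_matrix_mult_def)

lemma linear_vector_matrix_mult: "linear (\<lambda>x::real^'n. x v* (A::real^'m^'n))"
  by (rule linearI) (simp_all add: vector_matrix_left_distrib scaleR_vector_matrix_assoc)

lemma matrix_power_scaleR:
  fixes A :: "real^'n^'n"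
  shows "((**) (t *\<^sub>R A) ^^ k) (mat 1) = t ^ k *\<^sub>R ((**) A ^^ k) (mat 1)"
  by (induction k)
    (simp_all add: matrix_matrix_mult_def vec_eq_iff sum_distrib_left mult_ac)

lemma matrix_power_commute:
  fixes A :: "real^'n^'n"
  shows "A ** ((**) A ^^ k) (mat 1) = ((**) A ^^ k) (mat 1) ** A"
proof (induction k)
  case (Suc k)
  then show ?case by (metis comp_apply funpow.simps(2) matrix_mul_assoc)
qed simp

text \<open>Each entry of \<open>e\<^sup>t\<^sup>A\<close> is an everywhere convergent real power series in \<open>t\<close>, so that it can be
  differentiated term by term.\<close>

lemma matrix_exp_entry:
  fixes A :: "real^'n^'n"
  shows "matrix_exp (t *\<^sub>R A) $ i $ j = (\<Sum>k. ((((**) A ^^ k) (mat 1)) $ i $ j / fact k) * t ^ k)"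
    and "summable (\<lambda>k. ((((**) A ^^ k) (mat 1)) $ i $ j / fact k) * t ^ k)"
proof -
  have S: "(\<lambda>k. (1 / fact k) *\<^sub>R (((**) (t *\<^sub>R A) ^^ k) (mat 1))) sums matrix_exp (t *\<^sub>R A)"
    unfolding matrix_exp_def by (rule summable_sums[OF summable_matrix_exp])
  have "(\<lambda>k. ((1 / fact k) *\<^sub>R (((**) (t *\<^sub>R A) ^^ k) (mat 1))) $ i $ j)
      sums (matrix_exp (t *\<^sub>R A) $ i $ j)"
    by (intro bounded_linear.sums[OF bounded_linear_vec_nth] S)
  then have "(\<lambda>k. ((((**) A ^^ k) (mat 1)) $ i $ j / fact k) * t ^ k)
      sums (matrix_exp (t *\<^sub>R A) $ i $ j)"
    by (simp add: matrix_power_scaleR mult_ac)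
  then show "matrix_exp (t *\<^sub>R A) $ i $ j = (\<Sum>k. ((((**) A ^^ k) (mat 1)) $ i $ j / fact k) * t ^ k)"
    and "summable (\<lambda>k. ((((**) A ^^ k) (mat 1)) $ i $ j / fact k) * t ^ k)"
    by (auto simp: sums_iff)
qed

lemma matrix_exp_0: "matrix_exp (0 *\<^sub>R A) = mat 1"
  unfolding vec_eq_iff matrix_exp_entry(1) powser_zero by simp

lemma matrix_exp_entry_derivative:
  fixes A :: "real^'n^'n"
  shows "((\<lambda>t. matrix_exp (t *\<^sub>R A) $ i $ j) has_real_derivative
    (matrix_exp (t *\<^sub>R A) ** A) $ i $ j) (at t)"
proof -
  define P where "P k = ((**) A ^^ k) (mat 1)" for k
  have E: "(matrix_exp (t *\<^sub>R A) $ i $ j = (\<Sum>k. (P k $ i $ j / fact k) * t ^ k))"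
    and S: "summable (\<lambda>k. (P k $ i $ j / fact k) * t ^ k)" for t i j
    using matrix_exp_entry[where A = A] by (simp_all add: P_def)
  have "diffs (\<lambda>k. P k $ i $ j / fact k) n = (\<Sum>l\<in>UNIV. (P n $ i $ l / fact n) * A $ l $ j)" for n
  proof -
    have "P (Suc n) = P n ** A" by (simp add: P_def matrix_power_commute)
    then have "P (Suc n) $ i $ j = (\<Sum>l\<in>UNIV. P n $ i $ l * A $ l $ j)"
      by (simp add: matrix_matrix_mult_def)
    then show ?thesis
      by (simp add: diffs_def sum_divide_distrib field_simps del: of_nat_Suc)
  qed
  then have "(\<Sum>n. diffs (\<lambda>k. P k $ i $ j / fact k) n * t ^ n)
      = (\<Sum>n. \<Sum>l\<in>UNIV. ((P n $ i $ l / fact n) * t ^ n) * A $ l $ j)"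
    by (simp add: sum_distrib_left sum_distrib_right mult_ac)
  also have "\<dots> = (\<Sum>l\<in>UNIV. \<Sum>n. ((P n $ i $ l / fact n) * t ^ n) * A $ l $ j)"
    by (intro suminf_sum summable_mult2 S)
  also have "\<dots> = (matrix_exp (t *\<^sub>R A) ** A) $ i $ j"
    by (simp only: matrix_matrix_mult_def E suminf_mult2[OF S] vec_lambda_beta)
  finally show ?thesis
    using termdiffs_strong_converges_everywhere[OF S, of i j t] by (simp add: E)
qed

lemma semigroup_derivative:
  fixes Q :: "real^'n^'n" and \<mu> :: "real^'n"
  shows "((\<lambda>t. \<mu> v* matrix_exp (t *\<^sub>R Q)) has_vector_derivative
    (\<mu> v* matrix_exp (t *\<^sub>R Q)) v* Q) (at t within S)"
proof -
  have "((\<lambda>t. (\<mu> v* matrix_exp (t *\<^sub>R Q)) \<bullet> b) has_derivative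
      (\<lambda>h. (h *\<^sub>R ((\<mu> v* matrix_exp (t *\<^sub>R Q)) v* Q)) \<bullet> b)) (at t within S)"
    if basis: "b \<in> Basis" for b
  proof -
    obtain j where b: "b = axis j 1" using basis by (auto simp: Basis_vec_def)
    have "((\<lambda>t. \<Sum>i\<in>UNIV. \<mu> $ i * matrix_exp (t *\<^sub>R Q) $ i $ j) has_real_derivative
        (\<Sum>i\<in>UNIV. \<mu> $ i * (matrix_exp (t *\<^sub>R Q) ** Q) $ i $ j)) (at t within S)"
      by (intro DERIV_sum DERIV_cmult DERIV_subset[OF matrix_exp_entry_derivative]) simp
    then have "((\<lambda>t. (\<mu> v* matrix_exp (t *\<^sub>R Q)) $ j) has_real_derivative
        ((\<mu> v* matrix_exp (t *\<^sub>R Q)) v* Q) $ j) (at t within S)"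
      by (simp add: vector_matrix_mul_assoc vector_matrix_mult_component[where A = "matrix_exp _"]
          vector_matrix_mult_component[where A = "_ ** _"])
    then show ?thesis
      by (simp add: b inner_axis has_field_derivative_def mult_commute_abs)
  qed
  then show ?thesis
    unfolding has_vector_derivative_def has_derivative_componentwise_within[where f = "\<lambda>t. \<mu> v* matrix_exp (t *\<^sub>R Q)"]
    by blast
qed

lemma generator_row_sum: "generator Q \<Longrightarrow> (\<Sum>j\<in>UNIV. Q $ i $ j) = 0"
  unfolding generator_def by (subst sum.remove[of UNIV i]) auto

lemma generator_preserves_mass:
  assumes "generator Q"
  shows "x v* Q \<in> tangent"
proof -
  have "(\<Sum>j\<in>UNIV. (x v* Q) $ j) = (\<Sum>i\<in>UNIV. x $ i * (\<Sum>j\<in>UNIV. Q $ i $ j))"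
    unfolding vector_matrix_mult_component sum_distrib_left by (rule sum.swap)
  then show ?thesis by (simp add: tangent_def generator_row_sum[OF assms])
qed

text \<open>There is no first time at which a component vanishes: up to that time the inflow into the
  component is nonnegative, so the component decays at most exponentially.\<close>

lemma semigroup_preserves_pos_dists:
  fixes Q :: "real^'n^'n"
  assumes gen: "generator Q" and \<mu>: "\<mu> \<in> pos_dists" and t: "t \<ge> 0"
  shows "\<mu> v* matrix_exp (t *\<^sub>R Q) \<in> pos_dists"
proof -
  define x where "x t = \<mu> v* matrix_exp (t *\<^sub>R Q)" for t
  have x0: "x 0 = \<mu>" using matrix_exp_0[of Q] by (simp add: x_def)
  have dx: "((\<lambda>t. x t $ j) has_real_derivative (x t v* Q) $ j) (at t)" for j t
    using bounded_linear.has_vector_derivative[OF bounded_linear_vec_nth semigroup_derivative[of \<mu> Q t UNIV]]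
    by (simp add: x_def has_real_derivative_iff_has_vector_derivative)
  have "(\<Sum>j\<in>UNIV. x t $ j) = (\<Sum>j\<in>UNIV. x 0 $ j)"
  proof (rule DERIV_isconst_all[where f = "\<lambda>t. \<Sum>j\<in>UNIV. x t $ j"], rule allI)
    fix s
    have "((\<lambda>t. \<Sum>j\<in>UNIV. x t $ j) has_real_derivative (\<Sum>j\<in>UNIV. (x s v* Q) $ j)) (at s)"
      by (intro DERIV_sum dx)
    then show "((\<lambda>t. \<Sum>j\<in>UNIV. x t $ j) has_real_derivative 0) (at s)"
      using generator_preserves_mass[OF gen, of "x s"] by (simp add: tangent_def)
  qed
  then have sum: "(\<Sum>j\<in>UNIV. x t $ j) = 1" using \<mu> by (simp add: x0 pos_dists_def)
  have cont: "continuous_on A (\<lambda>t. x t $ j)" for A j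
    using dx by (meson DERIV_isCont continuous_at_imp_continuous_on)
  have pos: "x t $ j > 0" for j
  proof (rule ccontr)
    assume "\<not> x t $ j > 0"
    (* the times up to t at which some component is not positive; closed, hence with a first element *)
    define Z where "Z = (\<Union>j. {s \<in> {0..t}. x s $ j \<le> 0})"
    have "closed Z"
      unfolding Z_def
      by (intro closed_UN finite ballI continuous_closed_preimage_constant
          closed_Collect_le continuous_on_closed_Collect_le cont continuous_on_const) auto
    moreover have "t \<in> Z" using t \<open>\<not> x t $ j > 0\<close> by (auto simp: Z_def not_less)
    moreover have "bdd_below Z" by (rule bdd_belowI[of _ 0]) (auto simp: Z_def)
    ultimately have "Inf Z \<in> Z" by (intro closed_contains_Inf) auto
    define \<tau> where "\<tau> = Inf Z"
    obtain k where k: "x \<tau> $ k \<le> 0" "0 \<le> \<tau>"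
      using \<open>Inf Z \<in> Z\<close> by (auto simp: Z_def \<tau>_def)
    have before: "x s $ i > 0" if "0 \<le> s" "s < \<tau>" for s i
    proof (rule ccontr)
      assume "\<not> x s $ i > 0"
      then have "s \<in> Z" using that \<open>Inf Z \<in> Z\<close> by (auto simp: Z_def \<tau>_def not_less)
      then have "\<tau> \<le> s" unfolding \<tau>_def by (intro cInf_lower \<open>bdd_below Z\<close>)
      then show False using that by simp
    qed
    (* the integrating factor removes the outflow term, so that only the inflow remains in the derivative *)
    define y where "y s = exp (- (Q $ k $ k * s)) * x s $ k" for s
    have "y 0 \<le> y \<tau>"
    proof (rule DERIV_nonneg_imp_increasing_open[OF \<open>0 \<le> \<tau>\<close>])
      fix s assume s: "0 < s" "s < \<tau>"
      have "(x s v* Q) $ k = x s $ k * Q $ k $ k + (\<Sum>i\<in>UNIV-{k}. x s $ i * Q $ i $ k)"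
        unfolding vector_matrix_mult_component by (rule sum.remove) auto
      moreover have "(\<Sum>i\<in>UNIV-{k}. x s $ i * Q $ i $ k) \<ge> 0"
        using gen before[of s] s
        by (intro sum_nonneg mult_nonneg_nonneg) (auto simp: generator_def intro: less_imp_le)
      ultimately have "exp (- (Q $ k $ k * s)) * ((x s v* Q) $ k - x s $ k * Q $ k $ k) \<ge> 0"
        by simp
      moreover have "(y has_real_derivative
          exp (- (Q $ k $ k * s)) * ((x s v* Q) $ k - x s $ k * Q $ k $ k)) (at s)"
        unfolding y_def by (auto intro!: derivative_eq_intros dx simp: algebra_simps)
      ultimately show "\<exists>d. (y has_real_derivative d) (at s) \<and> 0 \<le> d" by blast
    next
      show "continuous_on {0..\<tau>} y" unfolding y_def by (intro continuous_intros cont)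
    qed
    moreover have "y 0 > 0" using \<mu> by (simp add: y_def x0 pos_dists_def)
    ultimately have "y \<tau> > 0" by simp
    then show False using k by (simp add: y_def zero_less_mult_iff)
  qed
  from sum pos show ?thesis by (simp add: pos_dists_def x_def)
qed

text \<open>Since the semigroup maps positive distributions to positive distributions and every positive
  distribution is an initial value, the gradient flow equation along trajectories is an identity
  between a vector field and a differential form on all of \<open>pos_dists\<close>.\<close>

lemma semigroup_is_gradient_flow_iff:
  fixes Q :: "real^'n^'n"
  assumes gen: "generator Q"
  shows "semigroup_is_gradient_flow Q F g \<longleftrightarrow>
    (\<forall>\<mu>\<in>pos_dists. F differentiable (at \<mu> within pos_dists) \<and>
      (\<forall>v\<in>tangent. g \<mu> (\<mu> v* Q) v = - differential F \<mu> v))"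
proof (intro iffI ballI)
  fix \<mu> :: "real^'n"
  assume flow: "semigroup_is_gradient_flow Q F g" and \<mu>: "\<mu> \<in> pos_dists"
  define \<rho> where "\<rho> t = \<mu> v* matrix_exp (t *\<^sub>R Q)" for t
  have \<rho>0: "\<rho> 0 = \<mu>" using matrix_exp_0[of Q] by (simp add: \<rho>_def)
  have "gradient_flow F g \<rho>"
    using flow \<mu> unfolding semigroup_is_gradient_flow_def \<rho>_def[abs_def] by blast
  then obtain r where r: "(\<rho> has_vector_derivative r) (at 0 within {0..})"
    and g: "\<forall>v\<in>tangent. g \<mu> r v = - differential F \<mu> v"
    and F: "F differentiable (at \<mu> within pos_dists)"
    unfolding gradient_flow_def using \<rho>0 by (metis order_refl)
  have "r = \<mu> v* Q"
  proof (rule vector_derivative_unique_within[OF _ r])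
    show "(\<rho> has_vector_derivative \<mu> v* Q) (at 0 within {0..})"
      using semigroup_derivative[of \<mu> Q 0 "{0..}"] \<rho>0 by (simp add: \<rho>_def[abs_def])
    show "at (0::real) within {0..} \<noteq> bot"
      using islimpt_subset[OF islimpt_greaterThanLessThan1[of 0 "1::real"], of "{0..}"]
      by (simp add: trivial_limit_within subset_eq)
  qed
  with F g show "F differentiable (at \<mu> within pos_dists) \<and>
      (\<forall>v\<in>tangent. g \<mu> (\<mu> v* Q) v = - differential F \<mu> v)" by simp
next
  assume "\<forall>\<mu>\<in>pos_dists. F differentiable (at \<mu> within pos_dists) \<and>
      (\<forall>v\<in>tangent. g \<mu> (\<mu> v* Q) v = - differential F \<mu> v)"
  then show "semigroup_is_gradient_flow Q F g"
    using semigroup_preserves_pos_dists[OF gen] semigroup_derivative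
    unfolding semigroup_is_gradient_flow_def gradient_flow_def by blast
qed

section \<open>Eigenvectors of self-adjoint operators\<close>

text \<open>A maximiser \<open>x\<close> of the Rayleigh quotient \<open>B(fx, x) / B(x, x)\<close> on \<open>V\<close> is an eigenvector: with
  \<open>c\<close> the maximum, the form \<open>c B(y, z) - B(fy, z)\<close> is positive semidefinite on \<open>V\<close> and vanishes at
  \<open>(x, x)\<close>, so \<open>c x - f x\<close>, which lies in \<open>V\<close>, is orthogonal to \<open>V\<close>.\<close>

lemma selfadjoint_has_eigenvector:
  fixes f :: "'a::euclidean_space \<Rightarrow> 'a"
  assumes f: "linear f" and B: "bilinear B"
    and sym: "\<And>x y. B x y = B y x" and pos: "\<And>x. x \<noteq> 0 \<Longrightarrow> B x x > (0::real)"
    and adj: "\<And>x y. B (f x) y = B x (f y)"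
    and V: "subspace V" "V \<noteq> {0}" and inv: "\<And>x. x \<in> V \<Longrightarrow> f x \<in> V"
  obtains x c where "x \<in> V" "x \<noteq> 0" "f x = c *\<^sub>R x"
proof -
  have bl: "bounded_bilinear B" using B by (simp add: bilinear_conv_bounded_bilinear)
  interpret B: bounded_bilinear B by (fact bl)
  have bf: "bounded_linear f" using f by (simp add: linear_conv_bounded_linear)
  define R where "R x = B (f x) x / B x x" for x
  let ?S = "V \<inter> sphere 0 1"
  have "compact ?S" using closed_subspace[OF V(1)] by (intro closed_Int_compact) auto
  moreover have "?S \<noteq> {}"
  proof -
    obtain x where "x \<in> V" "x \<noteq> 0" using V(2) subspace_0[OF V(1)] by blast
    then have "(1 / norm x) *\<^sub>R x \<in> ?S" using V(1) by (simp add: subspace_scale)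
    then show ?thesis by blast
  qed
  moreover have "continuous_on ?S R"
    unfolding R_def
  proof (intro continuous_on_divide B.continuous_on linear_continuous_on[OF bf] continuous_on_id ballI)
    fix x assume "x \<in> ?S"
    then have "x \<noteq> 0" by auto
    then show "B x x \<noteq> 0" using pos[of x] by simp
  qed
  ultimately obtain x where x: "x \<in> ?S" and max: "\<And>y. y \<in> ?S \<Longrightarrow> R y \<le> R x"
    using continuous_attains_sup[of ?S R] by metis
  have "x \<noteq> 0" "x \<in> V" using x by auto
  define C where "C y z = R x * B y z - B (f y) z" for y z
  have C_add: "C (y + z) w = C y w + C z w" "C w (y + z) = C w y + C w z"
    and C_scale: "C (c *\<^sub>R y) w = c * C y w" "C w (c *\<^sub>R y) = c * C w y" for y z w c
    by (simp_all add: C_def B.add_left B.add_right B.scaleR_left B.scaleR_right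
        linear_add[OF f] linear_scale[OF f] algebra_simps)
  have C_sym: "C y z = C z y" for y z
    using sym[of y z] adj[of y z] sym[of "f z" y] by (simp add: C_def)
  have C_nonneg: "C y y \<ge> 0" if "y \<in> V" for y
  proof (cases "y = 0")
    case False
    have "(1 / norm y) *\<^sub>R y \<in> ?S" using False that V(1) by (simp add: subspace_scale)
    from max[OF this] have "R y \<le> R x"
      using False by (simp add: R_def linear_scale[OF f] B.scaleR_left B.scaleR_right)
    then show ?thesis using pos[OF False] by (simp add: R_def C_def field_simps)
  qed (simp add: C_def B.zero_right)
  have "C x x = 0" using pos[OF \<open>x \<noteq> 0\<close>] by (simp add: C_def R_def)
  (* a positive semidefinite form that vanishes at (x, x) vanishes at (x, z) for all z *)
  have C0: "C x z = 0" if "z \<in> V" for z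
  proof (rule ccontr)
    assume nz: "C x z \<noteq> 0"
    (* the form at t x + z is affine in t with slope 2 C x z; this t gives it the value - 1 *)
    define t where "t = - (C z z + 1) / (2 * C x z)"
    have "C (t *\<^sub>R x + z) (t *\<^sub>R x + z) = 2 * t * C x z + C z z"
      using \<open>C x x = 0\<close> by (simp add: C_add C_scale C_sym[of z x] algebra_simps)
    also have "\<dots> = - 1" using nz by (simp add: t_def field_simps)
    finally show False
      using C_nonneg[of "t *\<^sub>R x + z"] that \<open>x \<in> V\<close> V(1)
      by (simp add: subspace_add subspace_scale)
  qed
  define z where "z = R x *\<^sub>R x - f x"
  have "z \<in> V" using \<open>x \<in> V\<close> inv V(1) by (simp add: z_def subspace_diff subspace_scale)
  then have "B z z = 0"
    using C0[of z] by (simp add: C_def z_def B.diff_left B.scaleR_left)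
  then have "z = 0" using pos[of z] by auto
  then have "f x = R x *\<^sub>R x" by (simp add: z_def)
  then show ?thesis using that \<open>x \<in> V\<close> \<open>x \<noteq> 0\<close> by blast
qed

text \<open>Split off an eigenvector; its orthogonal complement in \<open>V\<close> is invariant because \<open>f\<close> is
  self-adjoint, and it has smaller dimension. The inner product \<open>B\<close> is arbitrary, as the one that
  comes from a Riemannian metric is unrelated to the standard one.\<close>

lemma selfadjoint_eigenvectors_span:
  fixes f :: "'a::euclidean_space \<Rightarrow> 'a"
  assumes f: "linear f" and B: "bilinear B"
    and sym: "\<And>x y. B x y = B y x" and pos: "\<And>x. x \<noteq> 0 \<Longrightarrow> B x x > (0::real)"
    and adj: "\<And>x y. B (f x) y = B x (f y)"
    and V: "subspace V" and inv: "\<And>x. x \<in> V \<Longrightarrow> f x \<in> V"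
  shows "\<exists>E. (\<forall>x\<in>E. \<exists>c. f x = c *\<^sub>R x) \<and> span E = V"
  using V inv
proof (induction "dim V" arbitrary: V rule: less_induct)
  case less
  have bl: "bounded_bilinear B" using B by (simp add: bilinear_conv_bounded_bilinear)
  interpret B: bounded_bilinear B by (fact bl)
  show ?case
  proof (cases "V = {0}")
    case True
    then show ?thesis by (intro exI[of _ "{}"]) simp
  next
    case False
    obtain x c where x: "x \<in> V" "x \<noteq> 0" "f x = c *\<^sub>R x"
      using selfadjoint_has_eigenvector[OF f B sym pos adj less.prems(1) False less.prems(2)] by metis
    define W where "W = {y \<in> V. B x y = 0}"
    have W: "subspace W"
      using less.prems(1)
      by (auto simp: W_def subspace_def B.zero_right B.add_right B.scaleR_right)
    have "x \<notin> W" using pos[OF x(2)] by (simp add: W_def)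
    then have "W \<subset> V" using x(1) by (auto simp: W_def)
    then have "dim W < dim V"
      using W less.prems(1) by (metis dim_psubset span_eq_iff)
    moreover have "f y \<in> W" if "y \<in> W" for y
      using that less.prems(2) adj[of x y] x(3) by (auto simp: W_def B.scaleR_left)
    ultimately obtain E where E: "\<forall>x\<in>E. \<exists>c. f x = c *\<^sub>R x" "span E = W"
      using less.hyps[OF _ W] by metis
    have "span (insert x E) = V"
    proof
      have "E \<subseteq> V" using E(2) span_superset[of E] by (auto simp: W_def)
      then show "span (insert x E) \<subseteq> V" using x(1) less.prems(1) by (intro span_minimal) auto
      show "V \<subseteq> span (insert x E)"
      proof
        fix y assume "y \<in> V"
        define k where "k = B x y / B x x"
        have "B x (y - k *\<^sub>R x) = 0"
          using pos[OF x(2)] by (simp add: B.diff_right B.scaleR_right k_def)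
        then have "y - k *\<^sub>R x \<in> span E"
          using \<open>y \<in> V\<close> x(1) less.prems(1) by (simp add: E(2) W_def subspace_diff subspace_scale)
        then show "y \<in> span (insert x E)" by (auto simp: span_breakdown_eq)
      qed
    qed
    then show ?thesis using E(1) x(3) by (intro exI[of _ "insert x E"]) auto
  qed
qed

text \<open>The eigenvectors here are left ones, since distributions are row vectors. A basis of them forms
  the rows of a matrix \<open>P\<close> with \<open>PQ = DP\<close>, so the matrix \<open>S\<close> of the definition is the inverse of \<open>P\<close>.\<close>

lemma real_diagonalisable_if_eigenvectors_span:
  fixes Q :: "real^'n^'n"
  assumes eig: "\<forall>x\<in>E. \<exists>c. x v* Q = c *\<^sub>R x" and span: "span E = (UNIV :: (real^'n) set)"
  shows "real_diagonalisable Q"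
proof -
  obtain B where B: "B \<subseteq> E" "independent B" "E \<subseteq> span B"
    using maximal_independent_subset[of E] by metis
  have spanB: "span B = UNIV"
    using B(3) span by (metis span_mono span_span top.extremum_uniqueI)
  have "card B = CARD('n)"
    using dim_eq_card[OF _ B(2), of UNIV] spanB by simp
  then obtain b :: "'n \<Rightarrow> real^'n" where b: "bij_betw b UNIV B"
    using B(2) by (metis finite_class.finite_UNIV finiteI_independent finite_same_card_bij)
  then have b_in: "b i \<in> E" for i using B(1) by (auto simp: bij_betw_def)
  then have "\<forall>i. \<exists>c. b i v* Q = c *\<^sub>R b i" using eig by blast
  then obtain c where c: "\<And>i. b i v* Q = c i *\<^sub>R b i" by metis
  define P :: "real^'n^'n" where "P = (\<chi> i. b i)"
  define D :: "real^'n^'n" where "D = (\<chi> i j. if i = j then c i else 0)"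
  have "rows P = B"
    using b by (auto simp: rows_def row_def P_def bij_betw_def)
  then obtain S where S: "S ** P = mat 1"
    using matrix_left_invertible_span_rows[of P] spanB by auto
  then have PS: "P ** S = mat 1" by (simp add: matrix_left_right_inverse)
  have invS: "invertible S" unfolding invertible_def using S PS by blast
  have "S ** matrix_inv S = mat 1 \<and> matrix_inv S ** S = mat 1"
    using someI[of "\<lambda>A'. S ** A' = mat 1 \<and> A' ** S = mat 1" P] S PS
    unfolding matrix_inv_def by blast
  then have P: "matrix_inv S = P"
    using PS by (metis matrix_mul_assoc matrix_mul_lid matrix_mul_rid)
  have "P ** Q = D ** P"
  proof -
    have "(P ** Q) $ i = (D ** P) $ i" for i
    proof -
      have "(P ** Q) $ i = b i v* Q"
        by (simp add: P_def matrix_matrix_mult_def vector_matrix_mult_def)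
      moreover have "(D ** P) $ i = c i *\<^sub>R b i"
        by (simp add: P_def D_def matrix_matrix_mult_def vec_eq_iff mult_delta_left)
      ultimately show ?thesis using c by simp
    qed
    then show ?thesis by (simp add: vec_eq_iff)
  qed
  then have "Q = S ** D ** matrix_inv S"
    unfolding P by (metis S matrix_mul_assoc matrix_mul_lid)
  then show ?thesis
    unfolding real_diagonalisable_def using invS by (intro exI[of _ S] exI[of _ D]) (auto simp: D_def)
qed

section \<open>Second differences at the equilibrium\<close>

text \<open>By stationarity a state of mass zero has no inflow, so all its predecessors have mass zero as
  well; by irreducibility this spreads to every state, although the total mass is \<open>1\<close>.\<close>

lemma stationary_distribution_positive:
  fixes Q :: "real^'n^'n"
  assumes gen: "generator Q" and irr: "irreducible_chain Q" and st: "stationary_distribution Q \<pi>"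
  shows "\<pi> $ i > 0"
proof (rule ccontr)
  assume "\<not> \<pi> $ i > 0"
  then have i: "\<pi> $ i = 0" using st by (metis less_eq_real_def stationary_distribution_def)
  have pred: "\<pi> $ k = 0" if edge: "k \<noteq> l" "Q $ k $ l > 0" and l: "\<pi> $ l = 0" for k l
  proof -
    have "(\<Sum>m\<in>UNIV. \<pi> $ m * Q $ m $ l) = 0"
      using st by (simp add: stationary_distribution_def flip: vector_matrix_mult_component)
    moreover have "0 \<le> \<pi> $ m * Q $ m $ l" for m
      using gen st l by (cases "m = l") (auto simp: generator_def stationary_distribution_def)
    ultimately have "\<pi> $ k * Q $ k $ l = 0"
      by (subst (asm) sum_nonneg_eq_0_iff) auto
    then show ?thesis using edge by simp
  qed
  have "\<pi> $ k = 0" for k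
  proof -
    have "(k, i) \<in> {(k, l). k \<noteq> l \<and> Q $ k $ l > 0}\<^sup>*"
      using irr by (simp add: irreducible_chain_def)
    then show ?thesis
      by (induction rule: converse_rtrancl_induct) (use i pred in auto)
  qed
  then show False using st by (simp add: stationary_distribution_def)
qed

lemma stationary_distribution_in_pos_dists:
  assumes "generator Q" "irreducible_chain Q" "stationary_distribution Q \<pi>"
  shows "\<pi> \<in> pos_dists"
  using stationary_distribution_positive[OF assms] assms(3)
  by (simp add: pos_dists_def stationary_distribution_def)

lemma subspace_tangent: "subspace tangent"
  by (auto simp: subspace_def tangent_def sum.distrib simp flip: sum_distrib_left)

lemma pos_dists_contains_small_parallelogram:
  fixes \<pi> :: "real^'n"
  assumes \<pi>: "\<pi> \<in> pos_dists" and x: "x \<in> tangent" and y: "y \<in> tangent"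
  obtains e where "e > 0"
    and "\<And>s t. \<bar>s\<bar> < e \<Longrightarrow> \<bar>t\<bar> < e \<Longrightarrow> \<pi> + s *\<^sub>R x + t *\<^sub>R y \<in> pos_dists"
proof -
  have "open {v :: real^'n. \<forall>i. v $ i > 0}"
    unfolding Collect_all_eq by (intro open_INT finite ballI open_Collect_less continuous_intros)
  moreover have "\<pi> \<in> {v. \<forall>i. v $ i > 0}" using \<pi> by (simp add: pos_dists_def)
  ultimately obtain d where d: "d > 0" "ball \<pi> d \<subseteq> {v. \<forall>i. v $ i > 0}"
    by (meson open_contains_ball)
  define K where "K = norm x + norm y + 1"
  have K: "K > 0" by (simp add: K_def add_nonneg_pos)
  show ?thesis
  proof
    show "d / K > 0" using d K by simp
    fix s t :: real assume st: "\<bar>s\<bar> < d / K" "\<bar>t\<bar> < d / K"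
    have "norm (s *\<^sub>R x + t *\<^sub>R y) \<le> \<bar>s\<bar> * norm x + \<bar>t\<bar> * norm y"
      using norm_triangle_ineq[of "s *\<^sub>R x" "t *\<^sub>R y"] by simp
    also have "\<dots> \<le> d / K * norm x + d / K * norm y"
      using st by (intro add_mono mult_right_mono) auto
    also have "\<dots> < d / K * K" using d K by (simp add: K_def distrib_left)
    also have "\<dots> = d" using K by simp
    finally have "\<pi> + s *\<^sub>R x + t *\<^sub>R y \<in> ball \<pi> d"
      by (simp add: dist_norm add.assoc norm_minus_cancel[of "s *\<^sub>R x + t *\<^sub>R y", symmetric] del: norm_minus_cancel)
    then have "\<forall>i. (\<pi> + s *\<^sub>R x + t *\<^sub>R y) $ i > 0" using d by blast
    moreover have "(\<Sum>i\<in>UNIV. (\<pi> + s *\<^sub>R x + t *\<^sub>R y) $ i) = 1"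
      using \<pi> x y by (simp add: pos_dists_def tangent_def sum.distrib flip: sum_distrib_left)
    ultimately show "\<pi> + s *\<^sub>R x + t *\<^sub>R y \<in> pos_dists" by (simp add: pos_dists_def)
  qed
qed

lemma derivative_along_segment:
  assumes F: "F differentiable (at (a + t *\<^sub>R v) within pos_dists)"
    and S: "\<And>t. t \<in> S \<Longrightarrow> a + t *\<^sub>R v \<in> pos_dists"
  shows "((\<lambda>t. F (a + t *\<^sub>R v)) has_derivative (\<lambda>h. h * differential F (a + t *\<^sub>R v) v)) (at t within S)"
proof -
  have D: "(F has_derivative differential F (a + t *\<^sub>R v)) (at (a + t *\<^sub>R v) within pos_dists)"
    using F by (simp add: differential_def frechet_derivative_works)
  have "((\<lambda>t. a + t *\<^sub>R v) has_derivative (\<lambda>h. h *\<^sub>R v)) (at t within S)"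
    by (auto intro!: derivative_eq_intros)
  moreover have "(F has_derivative differential F (a + t *\<^sub>R v))
      (at (a + t *\<^sub>R v) within (\<lambda>t. a + t *\<^sub>R v) ` S)"
    using S by (intro has_derivative_subset[OF D]) auto
  ultimately have "(F \<circ> (\<lambda>t. a + t *\<^sub>R v) has_derivative
      differential F (a + t *\<^sub>R v) \<circ> (\<lambda>h. h *\<^sub>R v)) (at t within S)"
    by (rule diff_chain_within)
  then show ?thesis
    using linear_scale[OF has_derivative_linear[OF D]] by (simp add: o_def)
qed

definition second_difference :: "('a::real_vector \<Rightarrow> real) \<Rightarrow> 'a \<Rightarrow> 'a \<Rightarrow> 'a \<Rightarrow> real" where
  "second_difference F p x y = F (p + x + y) - F (p + x) - F (p + y) + F p"

lemma second_difference_commute: "second_difference F p x y = second_difference F p y x"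
  by (simp add: second_difference_def add.commute add.left_commute)

lemma metric_tendsto:
  assumes g: "C1_riemannian_metric g" and \<pi>: "\<pi> \<in> pos_dists" and u: "u \<in> tangent" and v: "v \<in> tangent"
    and p: "(p \<longlongrightarrow> \<pi>) F" and P: "eventually (\<lambda>s. p s \<in> pos_dists) F"
  shows "((\<lambda>s. g (p s) u v) \<longlongrightarrow> g \<pi> u v) F"
proof -
  have "C_k 0 (\<lambda>\<mu>. g \<mu> u v)"
    using g u v C_k_SucD[of 0 "\<lambda>\<mu>. g \<mu> u v"] unfolding C1_riemannian_metric_def One_nat_def by blast
  then have "continuous (at \<pi> within pos_dists) (\<lambda>\<mu>. g \<mu> u v)"
    using \<pi> by (simp add: continuous_on_eq_continuous_within)
  then show ?thesis using continuous_within_tendsto_compose[OF _ P p] by blast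
qed

lemma metric_add: "C1_riemannian_metric g \<Longrightarrow> \<mu> \<in> pos_dists \<Longrightarrow> u \<in> tangent \<Longrightarrow> v \<in> tangent \<Longrightarrow>
    w \<in> tangent \<Longrightarrow> g \<mu> (u + v) w = g \<mu> u w + g \<mu> v w"
  and metric_scale: "C1_riemannian_metric g \<Longrightarrow> \<mu> \<in> pos_dists \<Longrightarrow> u \<in> tangent \<Longrightarrow> v \<in> tangent \<Longrightarrow>
    g \<mu> (c *\<^sub>R u) v = c * g \<mu> u v"
  and metric_commute: "C1_riemannian_metric g \<Longrightarrow> \<mu> \<in> pos_dists \<Longrightarrow> u \<in> tangent \<Longrightarrow> v \<in> tangent \<Longrightarrow>
    g \<mu> u v = g \<mu> v u"
  by (simp_all add: C1_riemannian_metric_def inner_product_on_tangent_def)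

text \<open>The second difference is \<open>\<psi>(s) - \<psi>(0)\<close> for \<open>\<psi>(t) = F(\<pi> + sx + ty) - F(\<pi> + ty)\<close>. The mean value
  theorem yields \<open>\<theta>\<close> in \<open>(0, s)\<close> at which the difference is \<open>s \<psi>'(\<theta>)\<close>, and the flow identity evaluates
  \<open>\<psi>'(\<theta>)\<close> through the metric. As \<open>\<pi>Q = 0\<close>, each term carries a factor \<open>s\<close> or \<open>\<theta>\<close>; after division by
  \<open>s\<^sup>2\<close> the terms with \<open>\<theta>/s\<close> cancel in the limit by continuity of the metric, and the term
  \<open>- g\<^sub>\<pi>(xQ, y)\<close> survives.\<close>

lemma second_difference_tendsto:
  fixes Q :: "real^'n^'n"
  assumes gen: "generator Q" and g: "C1_riemannian_metric g"
    and flow: "semigroup_is_gradient_flow Q F g"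
    and \<pi>: "\<pi> \<in> pos_dists" "\<pi> v* Q = 0" and x: "x \<in> tangent" and y: "y \<in> tangent"
  shows "((\<lambda>s. second_difference F \<pi> (s *\<^sub>R x) (s *\<^sub>R y) / s\<^sup>2) \<longlongrightarrow> - g \<pi> (x v* Q) y) (at_right 0)"
proof -
  note flow' = flow[unfolded semigroup_is_gradient_flow_iff[OF gen], rule_format]
  obtain e where e: "e > 0"
    and P: "\<And>s t. \<bar>s\<bar> < e \<Longrightarrow> \<bar>t\<bar> < e \<Longrightarrow> \<pi> + s *\<^sub>R x + t *\<^sub>R y \<in> pos_dists"
    using pos_dists_contains_small_parallelogram[OF \<pi>(1) x y] by metis
  note xQ = generator_preserves_mass[OF gen, of x] and yQ = generator_preserves_mass[OF gen, of y]
  have lin: "linear (\<lambda>x. x v* Q)" by (rule linear_vector_matrix_mult)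
  have dF: "differential F (\<pi> + s *\<^sub>R x + t *\<^sub>R y) y
      = - (s * g (\<pi> + s *\<^sub>R x + t *\<^sub>R y) (x v* Q) y + t * g (\<pi> + s *\<^sub>R x + t *\<^sub>R y) (y v* Q) y)"
    if st: "\<bar>s\<bar> < e" "\<bar>t\<bar> < e" for s t
  proof -
    have "(\<pi> + s *\<^sub>R x + t *\<^sub>R y) v* Q = s *\<^sub>R (x v* Q) + t *\<^sub>R (y v* Q)"
      using \<pi>(2) by (simp add: linear_add[OF lin] linear_scale[OF lin])
    then show ?thesis
      using flow'[OF P[OF st], THEN conjunct2, rule_format, OF y] P[OF st] xQ yQ y
      by (simp add: metric_add[OF g] metric_scale[OF g] subspace_scale[OF subspace_tangent])
  qed
  have "\<exists>\<theta>. 0 < \<theta> \<and> \<theta> < s \<and> second_difference F \<pi> (s *\<^sub>R x) (s *\<^sub>R y) / s\<^sup>2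
      = - g (\<pi> + s *\<^sub>R x + \<theta> *\<^sub>R y) (x v* Q) y
        - (\<theta> / s) * (g (\<pi> + s *\<^sub>R x + \<theta> *\<^sub>R y) (y v* Q) y - g (\<pi> + \<theta> *\<^sub>R y) (y v* Q) y)"
    if s: "0 < s" "s < e" for s
  proof -
    define \<psi> where "\<psi> t = F (\<pi> + s *\<^sub>R x + t *\<^sub>R y) - F (\<pi> + t *\<^sub>R y)" for t
    have "\<exists>\<theta>\<in>{0<..<s}. \<psi> s - \<psi> 0
        = (s - 0) * (differential F (\<pi> + s *\<^sub>R x + \<theta> *\<^sub>R y) y) - (s - 0) * differential F (\<pi> + \<theta> *\<^sub>R y) y"
    proof (rule mvt_simple[OF s(1)])
      fix t assume t: "0 \<le> t" "t \<le> s"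
      have "\<pi> + t *\<^sub>R y \<in> pos_dists" "\<pi> + s *\<^sub>R x + t *\<^sub>R y \<in> pos_dists" if "t \<in> {0..s}" for t
        using P[of s t] P[of 0 t] s that by auto
      then show "(\<psi> has_derivative (\<lambda>h. h * differential F (\<pi> + s *\<^sub>R x + t *\<^sub>R y) y
          - h * differential F (\<pi> + t *\<^sub>R y) y)) (at t within {0..s})"
        unfolding \<psi>_def using flow' t by (intro has_derivative_diff derivative_along_segment) auto
    qed
    then obtain \<theta> where \<theta>: "0 < \<theta>" "\<theta> < s" and mv: "\<psi> s - \<psi> 0
        = s * (differential F (\<pi> + s *\<^sub>R x + \<theta> *\<^sub>R y) y - differential F (\<pi> + \<theta> *\<^sub>R y) y)"
      by (auto simp: right_diff_distrib)
    have "second_difference F \<pi> (s *\<^sub>R x) (s *\<^sub>R y) = \<psi> s - \<psi> 0"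
      by (simp add: second_difference_def \<psi>_def)
    also have "\<dots> = s * (- s * g (\<pi> + s *\<^sub>R x + \<theta> *\<^sub>R y) (x v* Q) y
        - \<theta> * (g (\<pi> + s *\<^sub>R x + \<theta> *\<^sub>R y) (y v* Q) y - g (\<pi> + \<theta> *\<^sub>R y) (y v* Q) y))"
    proof -
      have d: "differential F (\<pi> + \<theta> *\<^sub>R y) y = - (\<theta> * g (\<pi> + \<theta> *\<^sub>R y) (y v* Q) y)"
        using dF[of 0 \<theta>] s \<theta> e by simp
      show ?thesis
        unfolding mv d dF[of s \<theta>, simplified abs_of_pos[OF s(1)] abs_of_pos[OF \<theta>(1)], OF s(2) less_trans[OF \<theta>(2) s(2)]]
        by (simp add: algebra_simps)
    qed
    finally have sd: "second_difference F \<pi> (s *\<^sub>R x) (s *\<^sub>R y) = \<dots>" .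
    have cancel: "s * (- s * A - \<theta> * B) / s\<^sup>2 = - A - (\<theta> / s) * B" for A B
      using s(1) by (simp add: field_simps power2_eq_square)
    show ?thesis
      using \<theta> by (intro exI[of _ \<theta>]) (simp only: sd cancel simp_thms)
  qed
  then obtain \<theta> where \<theta>: "\<And>s. 0 < s \<Longrightarrow> s < e \<Longrightarrow> 0 < \<theta> s \<and> \<theta> s < s"
    and eq: "\<And>s. 0 < s \<Longrightarrow> s < e \<Longrightarrow> second_difference F \<pi> (s *\<^sub>R x) (s *\<^sub>R y) / s\<^sup>2
      = - g (\<pi> + s *\<^sub>R x + \<theta> s *\<^sub>R y) (x v* Q) y
        - (\<theta> s / s) * (g (\<pi> + s *\<^sub>R x + \<theta> s *\<^sub>R y) (y v* Q) y - g (\<pi> + \<theta> s *\<^sub>R y) (y v* Q) y)"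
    by metis
  have ev: "eventually (\<lambda>s. 0 < s \<and> s < e) (at_right 0)"
    using e by (auto simp: eventually_at_right_field)
  have s0: "((\<lambda>s. s) \<longlongrightarrow> 0) (at_right (0::real))" by (rule tendsto_ident_at)
  have \<theta>0: "(\<theta> \<longlongrightarrow> 0) (at_right 0)"
    by (rule tendsto_sandwich[OF _ _ tendsto_const s0])
      (use ev in eventually_elim, use \<theta> in \<open>auto intro: less_imp_le\<close>)+
  have "((\<lambda>s. \<pi> + s *\<^sub>R x + \<theta> s *\<^sub>R y) \<longlongrightarrow> \<pi> + 0 *\<^sub>R x + 0 *\<^sub>R y) (at_right 0)"
    and "((\<lambda>s. \<pi> + \<theta> s *\<^sub>R y) \<longlongrightarrow> \<pi> + 0 *\<^sub>R y) (at_right 0)"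
    by (intro tendsto_intros \<theta>0 s0)+
  then have pq: "((\<lambda>s. \<pi> + s *\<^sub>R x + \<theta> s *\<^sub>R y) \<longlongrightarrow> \<pi>) (at_right 0)"
      "((\<lambda>s. \<pi> + \<theta> s *\<^sub>R y) \<longlongrightarrow> \<pi>) (at_right 0)"
    by simp_all
  have evP: "eventually (\<lambda>s. \<pi> + s *\<^sub>R x + \<theta> s *\<^sub>R y \<in> pos_dists) (at_right 0)"
    using ev by eventually_elim (intro P, use \<theta> in force, use \<theta> in force)
  have evQ: "eventually (\<lambda>s. \<pi> + \<theta> s *\<^sub>R y \<in> pos_dists) (at_right 0)"
    using ev
  proof eventually_elim
    case (elim s)
    then show ?case using P[of 0 "\<theta> s"] \<theta>[of s] e by simp
  qed
  have "((\<lambda>s. g (\<pi> + s *\<^sub>R x + \<theta> s *\<^sub>R y) (y v* Q) y - g (\<pi> + \<theta> s *\<^sub>R y) (y v* Q) y)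
      \<longlongrightarrow> g \<pi> (y v* Q) y - g \<pi> (y v* Q) y) (at_right 0)"
    by (intro tendsto_diff metric_tendsto[OF g \<pi>(1) yQ y] pq evP evQ)
  then have "((\<lambda>s. g (\<pi> + s *\<^sub>R x + \<theta> s *\<^sub>R y) (y v* Q) y - g (\<pi> + \<theta> s *\<^sub>R y) (y v* Q) y)
      \<longlongrightarrow> 0) (at_right 0)" by simp
  then have "((\<lambda>s. (\<theta> s / s) * (g (\<pi> + s *\<^sub>R x + \<theta> s *\<^sub>R y) (y v* Q) y - g (\<pi> + \<theta> s *\<^sub>R y) (y v* Q) y))
      \<longlongrightarrow> 0) (at_right 0)"
  proof (rule tendsto_0_le[where K = 1])
    have ratio: "\<bar>\<theta> s / s\<bar> \<le> 1" if "0 < s \<and> s < e" for s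
      using \<theta>[of s] that by (simp add: divide_le_eq)
    show "\<forall>\<^sub>F s in at_right 0.
        norm ((\<theta> s / s) * (g (\<pi> + s *\<^sub>R x + \<theta> s *\<^sub>R y) (y v* Q) y - g (\<pi> + \<theta> s *\<^sub>R y) (y v* Q) y))
        \<le> norm (g (\<pi> + s *\<^sub>R x + \<theta> s *\<^sub>R y) (y v* Q) y - g (\<pi> + \<theta> s *\<^sub>R y) (y v* Q) y) * 1"
      using ev
    proof eventually_elim
      case (elim s)
      then show ?case
        unfolding real_norm_def abs_mult[of "\<theta> s / s"] mult_1_right
        by (intro mult_left_le_one_le ratio) auto
    qed
  qed
  then have "((\<lambda>s. - g (\<pi> + s *\<^sub>R x + \<theta> s *\<^sub>R y) (x v* Q) y
        - (\<theta> s / s) * (g (\<pi> + s *\<^sub>R x + \<theta> s *\<^sub>R y) (y v* Q) y - g (\<pi> + \<theta> s *\<^sub>R y) (y v* Q) y))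
      \<longlongrightarrow> - g \<pi> (x v* Q) y - 0) (at_right 0)"
    by (rule tendsto_diff[OF tendsto_minus[OF metric_tendsto[OF g \<pi>(1) xQ y pq(1) evP]]])
  then have lim: "((\<lambda>s. - g (\<pi> + s *\<^sub>R x + \<theta> s *\<^sub>R y) (x v* Q) y
        - (\<theta> s / s) * (g (\<pi> + s *\<^sub>R x + \<theta> s *\<^sub>R y) (y v* Q) y - g (\<pi> + \<theta> s *\<^sub>R y) (y v* Q) y))
      \<longlongrightarrow> - g \<pi> (x v* Q) y) (at_right 0)" by simp
  show ?thesis
    by (rule Lim_transform_eventually[OF lim], rule eventually_mono[OF ev], rule eq[symmetric]) auto
qed

text \<open>The limit of the second difference is the same with \<open>x\<close> and \<open>y\<close> exchanged.\<close>

lemma generator_selfadjoint_at_equilibrium: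
  fixes Q :: "real^'n^'n"
  assumes gen: "generator Q" and g: "C1_riemannian_metric g"
    and flow: "semigroup_is_gradient_flow Q F g"
    and \<pi>: "\<pi> \<in> pos_dists" "\<pi> v* Q = 0" and x: "x \<in> tangent" and y: "y \<in> tangent"
  shows "g \<pi> (x v* Q) y = g \<pi> x (y v* Q)"
proof -
  have "((\<lambda>s. second_difference F \<pi> (s *\<^sub>R x) (s *\<^sub>R y) / s\<^sup>2) \<longlongrightarrow> - g \<pi> (y v* Q) x) (at_right 0)"
    by (subst second_difference_commute) (rule second_difference_tendsto[OF assms(1-5) y x])
  from tendsto_unique[OF trivial_limit_at_right_real this second_difference_tendsto[OF assms(1-5) x y]]
  have "g \<pi> (x v* Q) y = g \<pi> (y v* Q) x" by simp
  then show ?thesis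
    using metric_commute[OF g \<pi>(1) generator_preserves_mass[OF gen] x] by simp
qed

section \<open>Consequences of a gradient flow structure\<close>

text \<open>Every vector is the sum of a tangent vector and a multiple of \<open>\<pi>\<close>; declare the two summands
  orthogonal and \<open>\<pi>\<close> a unit vector. The map \<open>p\<close> is the projection to the tangent space along \<open>\<pi>\<close>.\<close>

lemma inner_product_extends_from_tangent:
  fixes b :: "real^'n \<Rightarrow> real^'n \<Rightarrow> real" and \<pi> :: "real^'n"
  assumes b: "inner_product_on_tangent b" and \<pi>: "(\<Sum>i\<in>UNIV. \<pi> $ i) = 1"
  obtains B p where "bilinear B" "\<And>x y. B x y = B y x" "\<And>x. x \<noteq> 0 \<Longrightarrow> B x x > 0"
    "\<And>x. p x \<in> tangent" "\<And>x. \<exists>c. p x = x - c *\<^sub>R \<pi>"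
    "\<And>x y. x \<in> tangent \<Longrightarrow> B x y = b x (p y)"
proof -
  define m where "m x = (\<Sum>i\<in>UNIV. x $ i)" for x :: "real^'n"
  define p where "p x = x - m x *\<^sub>R \<pi>" for x
  define B where "B x y = b (p x) (p y) + m x * m y" for x y
  have lin_m: "m (x + y) = m x + m y" "m (c *\<^sub>R x) = c * m x" for x y c
    by (simp_all add: m_def sum.distrib sum_distrib_left)
  have lin_p: "p (x + y) = p x + p y" "p (c *\<^sub>R x) = c *\<^sub>R p x" for x y c
    by (simp_all add: p_def lin_m algebra_simps)
  have p_tangent: "p x \<in> tangent" for x
    using \<pi> by (simp add: p_def tangent_def m_def sum_subtractf flip: sum_distrib_left)
  have m_tangent: "m x = 0" if "x \<in> tangent" for x using that by (simp add: m_def tangent_def)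
  have b_add: "b (u + v) w = b u w + b v w" and b_scale: "b (c *\<^sub>R u) v = c * b u v"
    and b_sym: "b u v = b v u" and b_pos: "u \<noteq> 0 \<Longrightarrow> b u u > 0"
    if "u \<in> tangent" "v \<in> tangent" "w \<in> tangent" for u v w c
    using b that unfolding inner_product_on_tangent_def by blast+
  have B_sym: "B x y = B y x" for x y
    using b_sym[OF p_tangent p_tangent p_tangent, of x y] by (simp add: B_def)
  have lin_B: "linear (\<lambda>x. B x y)" for y
  proof (rule linearI)
    show "B (u + v) y = B u y + B v y" for u v
      using b_add[OF p_tangent p_tangent p_tangent, of u v y]
      by (simp add: B_def lin_m lin_p algebra_simps)
    show "B (c *\<^sub>R u) y = c *\<^sub>R B u y" for c u
      using b_scale[OF p_tangent p_tangent p_tangent, of c u y]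
      by (simp add: B_def lin_m lin_p algebra_simps)
  qed
  have "B x = (\<lambda>y. B y x)" for x by (rule ext) (rule B_sym)
  then have "bilinear B"
    unfolding bilinear_def using lin_B by metis
  moreover have "B x x > 0" if "x \<noteq> 0" for x
  proof (cases "p x = 0")
    case True
    then have "m x \<noteq> 0" using that by (auto simp: p_def)
    moreover have "b (p x) (p x) = 0"
      using b_scale[OF p_tangent p_tangent p_tangent, of 0 x x] True by simp
    ultimately show ?thesis by (auto simp: B_def zero_less_mult_iff)
  next
    case False
    then show ?thesis using b_pos[OF p_tangent p_tangent p_tangent, of x] by (simp add: B_def add_pos_nonneg)
  qed
  moreover have "\<exists>c. p x = x - c *\<^sub>R \<pi>" for x by (auto simp: p_def)
  moreover have "B x y = b x (p y)" if "x \<in> tangent" for x y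
    using m_tangent[OF that] by (simp_all add: p_def B_def)
  ultimately show ?thesis using that[of B p] B_sym p_tangent by blast
qed

text \<open>The generator is self-adjoint on the tangent space for \<open>g\<^sub>\<pi>\<close> and annihilates \<open>\<pi>\<close>, so it is
  self-adjoint on the whole space for the extended inner product.\<close>

lemma gradient_flow_imp_real_diagonalisable:
  fixes Q :: "real^'n^'n"
  assumes gen: "generator Q" and g: "C1_riemannian_metric g"
    and flow: "semigroup_is_gradient_flow Q F g"
    and \<pi>: "\<pi> \<in> pos_dists" "\<pi> v* Q = 0"
  shows "real_diagonalisable Q"
proof -
  have ip: "inner_product_on_tangent (g \<pi>)"
    using g \<pi>(1) unfolding C1_riemannian_metric_def by blast
  have mass: "(\<Sum>i\<in>UNIV. \<pi> $ i) = 1" using \<pi>(1) by (simp add: pos_dists_def)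
  obtain B p where B: "bilinear B" "\<And>x y. B x y = B y x" "\<And>x. x \<noteq> 0 \<Longrightarrow> B x x > 0"
    and p: "\<And>x. p x \<in> tangent" "\<And>x. \<exists>c. p x = x - c *\<^sub>R \<pi>"
      "\<And>x y. x \<in> tangent \<Longrightarrow> B x y = g \<pi> x (p y)"
    by (fact inner_product_extends_from_tangent[OF ip mass])
  have lin: "linear (\<lambda>x. x v* Q)" by (rule linear_vector_matrix_mult)
  have pQ: "p x v* Q = x v* Q" for x
  proof -
    obtain c where "p x = x - c *\<^sub>R \<pi>" using p(2) by blast
    then show ?thesis using \<pi>(2) by (simp add: linear_diff[OF lin] linear_scale[OF lin])
  qed
  have BQ: "B (x v* Q) y = g \<pi> (p x v* Q) (p y)" for x y
    using p(3)[OF generator_preserves_mass[OF gen]] by (simp add: pQ)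
  have "B (x v* Q) y = B x (y v* Q)" for x y
  proof -
    have "B (x v* Q) y = g \<pi> (p x) (p y v* Q)"
      unfolding BQ by (rule generator_selfadjoint_at_equilibrium[OF gen g flow \<pi> p(1) p(1)])
    also have "\<dots> = g \<pi> (p y v* Q) (p x)"
      by (rule metric_commute[OF g \<pi>(1) p(1) generator_preserves_mass[OF gen]])
    also have "\<dots> = B (y v* Q) x" unfolding BQ ..
    finally show ?thesis using B(2) by simp
  qed
  then obtain E where "\<forall>x\<in>E. \<exists>c. x v* Q = c *\<^sub>R x" "span E = (UNIV :: (real^'n) set)"
    using selfadjoint_eigenvectors_span[OF lin B, of UNIV] by auto
  then show ?thesis by (rule real_diagonalisable_if_eigenvectors_span)
qed

text \<open>At \<open>\<pi> + sx\<close> the flow identity reads \<open>s g(xQ, y) = - \<Sum> y\<^sub>i ln (1 + s x\<^sub>i / \<pi>\<^sub>i)\<close>, since the constant in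
  the differential of the entropy vanishes on tangent vectors. Divide by \<open>s\<close> and let \<open>s\<close> tend to
  zero.\<close>

lemma entropy_flow_metric_at_equilibrium:
  fixes Q :: "real^'n^'n"
  assumes gen: "generator Q" and g: "C1_riemannian_metric g"
    and flow: "semigroup_is_gradient_flow Q (relative_entropy \<pi>) g"
    and \<pi>: "\<pi> \<in> pos_dists" "\<pi> v* Q = 0" and x: "x \<in> tangent" and y: "y \<in> tangent"
  shows "g \<pi> (x v* Q) y = - (\<Sum>i\<in>UNIV. x $ i * y $ i / \<pi> $ i)"
proof -
  have pos: "\<pi> $ i > 0" for i using \<pi> by (simp add: pos_dists_def)
  have nz: "\<pi> $ i \<noteq> 0" for i using pos[of i] by simp
  note flow' = flow[unfolded semigroup_is_gradient_flow_iff[OF gen], rule_format]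
  note xQ = generator_preserves_mass[OF gen, of x]
  have lin: "linear (\<lambda>x. x v* Q)" by (rule linear_vector_matrix_mult)
  obtain e where e: "e > 0"
    and P: "\<And>s t. \<bar>s\<bar> < e \<Longrightarrow> \<bar>t\<bar> < e \<Longrightarrow> \<pi> + s *\<^sub>R x + t *\<^sub>R y \<in> pos_dists"
    using pos_dists_contains_small_parallelogram[OF \<pi>(1) x y] by metis
  have ev: "eventually (\<lambda>s. s \<noteq> 0 \<and> \<bar>s\<bar> < e) (at 0)"
    using e by (auto simp: eventually_at intro!: exI[of _ e])
  have Px: "\<pi> + s *\<^sub>R x \<in> pos_dists" if "\<bar>s\<bar> < e" for s using P[OF that, of 0] e by simp
  define h where "h s = (\<Sum>i\<in>UNIV. y $ i * ln (1 + s * (x $ i / \<pi> $ i)))" for s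
  have "g (\<pi> + s *\<^sub>R x) (x v* Q) y = - (h s / s)" if s: "s \<noteq> 0 \<and> \<bar>s\<bar> < e" for s
  proof -
    have S: "\<pi> + s *\<^sub>R x \<in> pos_dists" using Px s by simp
    have "s * g (\<pi> + s *\<^sub>R x) (x v* Q) y = g (\<pi> + s *\<^sub>R x) ((\<pi> + s *\<^sub>R x) v* Q) y"
      using \<pi>(2) metric_scale[OF g S xQ y] by (simp add: linear_add[OF lin] linear_scale[OF lin])
    also have "\<dots> = - differential (relative_entropy \<pi>) (\<pi> + s *\<^sub>R x) y"
      using flow'[OF S] y by blast
    also have "\<dots> = - (\<Sum>i\<in>UNIV. y $ i * (ln ((\<pi> + s *\<^sub>R x) $ i / \<pi> $ i) + 1))"
      by (subst differential_eq[OF relative_entropy_has_derivative[OF S pos] S y]) simp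
    also have "\<dots> = - h s"
    proof -
      have "(\<pi> + s *\<^sub>R x) $ i / \<pi> $ i = 1 + s * (x $ i / \<pi> $ i)" for i
        using pos[of i] by (simp add: field_simps)
      then show ?thesis
        using y by (simp only: h_def distrib_left sum.distrib tangent_def mem_Collect_eq) simp
    qed
    finally show ?thesis using s by (simp add: field_simps)
  qed
  then have "eventually (\<lambda>s. - (h s / s) = g (\<pi> + s *\<^sub>R x) (x v* Q) y) (at 0)"
    using ev by (auto elim: eventually_mono)
  moreover have "((\<lambda>s. - (h s / s)) \<longlongrightarrow> - (\<Sum>i\<in>UNIV. x $ i * y $ i / \<pi> $ i)) (at 0)"
  proof -
    have "(h has_real_derivative (\<Sum>i\<in>UNIV. y $ i * (x $ i / \<pi> $ i))) (at 0)"
      unfolding h_def by (auto intro!: derivative_eq_intros simp: nz mult.commute)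
    then have "((\<lambda>s. h s / s) \<longlongrightarrow> (\<Sum>i\<in>UNIV. x $ i * y $ i / \<pi> $ i)) (at 0)"
      by (simp add: DERIV_def h_def mult.commute)
    then show ?thesis by (rule tendsto_minus)
  qed
  ultimately have "((\<lambda>s. g (\<pi> + s *\<^sub>R x) (x v* Q) y) \<longlongrightarrow> - (\<Sum>i\<in>UNIV. x $ i * y $ i / \<pi> $ i)) (at 0)"
    by (rule Lim_transform_eventually[rotated])
  moreover have "((\<lambda>s. \<pi> + s *\<^sub>R x) \<longlongrightarrow> \<pi> + 0 *\<^sub>R x) (at 0)" by (intro tendsto_intros)
  then have "((\<lambda>s. g (\<pi> + s *\<^sub>R x) (x v* Q) y) \<longlongrightarrow> g \<pi> (x v* Q) y) (at 0)"
    using ev Px by (intro metric_tendsto[OF g \<pi>(1) xQ y]) (auto elim: eventually_mono)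
  ultimately show ?thesis by (intro tendsto_unique[OF trivial_limit_at]) auto
qed

text \<open>Writing \<open>b(x, y) = \<Sum> x\<^sub>k y\<^sub>k / \<pi>\<^sub>k\<close>, the form \<open>b(xQ, y) = - g\<^sub>\<pi>(xQ, yQ)\<close> is symmetric on tangent
  vectors. For the tangent vectors \<open>u\<^sub>l = e\<^sub>l - \<pi>\<close> one has \<open>b(u\<^sub>i Q, u\<^sub>j) = Q\<^sub>i\<^sub>j / \<pi>\<^sub>j\<close>, and the symmetry
  becomes detailed balance.\<close>

lemma entropy_gradient_flow_imp_time_reversible:
  fixes Q :: "real^'n^'n"
  assumes gen: "generator Q" and g: "C1_riemannian_metric g"
    and flow: "semigroup_is_gradient_flow Q (relative_entropy \<pi>) g"
    and \<pi>: "\<pi> \<in> pos_dists" "\<pi> v* Q = 0"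
  shows "time_reversible Q \<pi>"
  unfolding time_reversible_def
proof (intro allI)
  fix i j
  define b where "b x y = (\<Sum>k\<in>UNIV. x $ k * y $ k / \<pi> $ k)" for x y :: "real^'n"
  define u where "u l = axis l 1 - \<pi>" for l
  have pos: "\<pi> $ k > 0" for k using \<pi> by (simp add: pos_dists_def)
  have lin: "linear (\<lambda>x. x v* Q)" by (rule linear_vector_matrix_mult)
  have b_eq: "b x y = - g \<pi> (x v* Q) y" if "x \<in> tangent" "y \<in> tangent" for x y
    using entropy_flow_metric_at_equilibrium[OF assms that] by (simp add: b_def)
  have T: "x v* Q \<in> tangent" for x by (rule generator_preserves_mass[OF gen])
  have u: "u l \<in> tangent" for l
    using \<pi> by (simp add: u_def tangent_def pos_dists_def axis_def sum_subtractf)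
  have uQ: "(u l v* Q) $ k = Q $ l $ k" for l k
    using \<pi>(2) by (simp add: u_def linear_diff[OF lin] vector_matrix_mult_component axis_def mult_delta_left)
  have bu: "b (u l v* Q) (u k) = Q $ l $ k / \<pi> $ k" for l k
  proof -
    have "b (u l v* Q) (u k) = (\<Sum>m\<in>UNIV. (if m = k then Q $ l $ m / \<pi> $ m else 0) - Q $ l $ m)"
      unfolding b_def uQ using pos[THEN less_imp_neq]
      by (intro sum.cong) (auto simp: u_def axis_def field_simps)
    then show ?thesis by (simp add: sum_subtractf generator_row_sum[OF gen])
  qed
  have "b (u i v* Q) (u j) = - g \<pi> ((u i v* Q) v* Q) (u j)" by (rule b_eq[OF T u])
  also have "\<dots> = - g \<pi> (u i v* Q) (u j v* Q)"
    by (simp add: generator_selfadjoint_at_equilibrium[OF gen g flow \<pi> T u])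
  also have "\<dots> = - g \<pi> ((u j v* Q) v* Q) (u i)"
    using generator_selfadjoint_at_equilibrium[OF gen g flow \<pi> T[of "u j"] u[of i]]
      metric_commute[OF g \<pi>(1) T T] by simp
  also have "\<dots> = b (u j v* Q) (u i)" by (rule b_eq[OF T u, symmetric])
  finally show "\<pi> $ i * Q $ i $ j = \<pi> $ j * Q $ j $ i"
    using pos[of i] pos[of j] by (simp add: bu field_simps)
qed

section \<open>A quadratic functional for a diagonalisable generator\<close>

text \<open>In the coordinates \<open>\<xi> = \<mu>S\<close> the vector field \<open>\<mu>Q\<close> has components \<open>d\<^sub>k \<xi>\<^sub>k\<close>, with \<open>d\<^sub>k\<close> the diagonal
  entries of \<open>D\<close>. The metric is the constant Euclidean one in these coordinates, and
  \<open>F = - \<Sum> d\<^sub>k \<xi>\<^sub>k\<^sup>2 / 2\<close>.\<close>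

lemma real_diagonalisable_imp_gradient_flow:
  fixes Q :: "real^'n^'n"
  assumes gen: "generator Q" and diag: "real_diagonalisable Q"
  shows "\<exists>g F. C1_riemannian_metric g \<and> C_k 2 F \<and> semigroup_is_gradient_flow Q F g"
proof -
  obtain S D :: "real^'n^'n" where S: "invertible S" and D: "\<And>i j. i \<noteq> j \<Longrightarrow> D $ i $ j = 0"
    and Q: "Q = S ** D ** matrix_inv S"
    using diag unfolding real_diagonalisable_def by blast
  have "\<exists>A'. S ** A' = mat 1 \<and> A' ** S = mat 1" using S by (simp add: invertible_def)
  then have inv: "S ** matrix_inv S = mat 1" "matrix_inv S ** S = mat 1"
    unfolding matrix_inv_def by (rule someI2_ex; blast)+
  have lin: "linear (\<lambda>x. (x v* S) $ k)" for k
    by (rule linearI) (simp_all add: vector_matrix_left_distrib scaleR_vector_matrix_assoc)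
  have inj: "x = 0" if "x v* S = 0" for x
    using that inv(1) by (metis vector_matrix_mul_assoc vector_matrix_mul_rid vector_matrix_mult_0)
  have QS: "((x v* Q) v* S) $ k = (x v* S) $ k * D $ k $ k" for x k
  proof -
    have "Q ** S = S ** D" unfolding Q using inv(2) by (metis matrix_mul_assoc matrix_mul_rid)
    then have "((x v* Q) v* S) $ k = (\<Sum>l\<in>UNIV. (x v* S) $ l * D $ l $ k)"
      by (metis vector_matrix_mul_assoc vector_matrix_mult_component)
    also have "\<dots> = (\<Sum>l\<in>{k}. (x v* S) $ l * D $ l $ k)"
      by (rule sum.mono_neutral_right) (auto simp: D)
    finally show ?thesis by simp
  qed
  define g :: "real^'n \<Rightarrow> real^'n \<Rightarrow> real^'n \<Rightarrow> real"
    where "g \<mu> u v = (\<Sum>k\<in>UNIV. (u v* S) $ k * (v v* S) $ k)" for \<mu> u v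
  define F where "F \<mu> = - (\<Sum>k\<in>UNIV. D $ k $ k / 2 * ((\<mu> v* S) $ k * (\<mu> v* S) $ k))" for \<mu>
  have "inner_product_on_tangent (g \<mu>)" for \<mu>
    unfolding inner_product_on_tangent_def
  proof (intro conjI ballI allI impI)
    fix u :: "real^'n" assume "u \<noteq> 0"
    then obtain k where "(u v* S) $ k \<noteq> 0" using inj by (auto simp: vec_eq_iff)
    then show "g \<mu> u u > 0"
      unfolding g_def by (intro sum_pos2[of _ k]) (auto simp: zero_less_mult_iff)
  qed (auto simp: g_def linear_add[OF lin] linear_scale[OF lin] sum.distrib sum_distrib_left
      algebra_simps)
  moreover have "C_k 1 (\<lambda>\<mu>. g \<mu> v w)" for v w
    unfolding g_def by (rule C_k_const)
  ultimately have "C1_riemannian_metric g" by (simp add: C1_riemannian_metric_def)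
  moreover have "C_k 2 F"
    unfolding F_def
    by (rule C_k_uminus, rule C_k_sum, rule C_k_mult, rule C_k_const, rule C_k_mult; rule C_k_linear[OF lin])
  moreover have "semigroup_is_gradient_flow Q F g"
    unfolding semigroup_is_gradient_flow_iff[OF gen]
  proof (intro ballI conjI)
    fix \<mu> :: "real^'n" assume \<mu>: "\<mu> \<in> pos_dists"
    have "(F has_derivative (\<lambda>v. - (\<Sum>k\<in>UNIV. D $ k $ k / 2 *
        ((\<mu> v* S) $ k * (v v* S) $ k + (v v* S) $ k * (\<mu> v* S) $ k)))) (at \<mu> within pos_dists)"
      unfolding F_def
      by (intro has_derivative_minus has_derivative_sum has_derivative_mult_right has_derivative_mult
          linear_imp_has_derivative lin)
    then have dF: "(F has_derivative (\<lambda>v. - g \<mu> (\<mu> v* Q) v)) (at \<mu> within pos_dists)"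
      unfolding g_def QS by (rule has_derivative_eq_rhs) (simp add: fun_eq_iff mult_ac)
    then show "F differentiable (at \<mu> within pos_dists)" by (auto simp: differentiable_def)
    show "g \<mu> (\<mu> v* Q) v = - differential F \<mu> v" if "v \<in> tangent" for v
      using differential_eq[OF dF \<mu> that] by simp
  qed
  ultimately show ?thesis by blast
qed

section \<open>The entropic metric of a reversible chain\<close>

text \<open>The function \<open>(exp y - 1) / y\<close>, extended by \<open>1\<close> at the origin. The power series makes it evident
  that the singularity is removable, which matters because it is hit whenever
  \<open>\<mu>\<^sub>i / \<pi>\<^sub>i = \<mu>\<^sub>j / \<pi>\<^sub>j\<close>, in particular at the equilibrium.\<close>

definition exp_quotient :: "real \<Rightarrow> real" where
  "exp_quotient y = (\<Sum>n. (1 / fact (Suc n)) * y ^ n)"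

lemma summable_exp_quotient: "summable (\<lambda>n. (1 / fact (Suc n)) * (y::real) ^ n)"
proof (rule summable_comparison_test'[where N = 0])
  show "summable (\<lambda>n. inverse (fact n) * \<bar>y\<bar> ^ n)" by (rule summable_exp)
  show "norm ((1 / fact (Suc n)) * y ^ n) \<le> inverse (fact n) * \<bar>y\<bar> ^ n" for n
  proof -
    have "fact n \<le> (fact (Suc n) :: real)" by (rule fact_mono) simp
    then have "1 / fact (Suc n) \<le> (inverse (fact n) :: real)" by (simp add: field_simps del: fact_Suc)
    then have "1 / fact (Suc n) * \<bar>y\<bar> ^ n \<le> inverse (fact n) * \<bar>y\<bar> ^ n"
      by (rule mult_right_mono) simp
    then show ?thesis by (simp add: abs_mult power_abs del: fact_Suc)
  qed
qed

lemma mult_exp_quotient: "y * exp_quotient y = exp y - 1"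
proof -
  have "exp y = (\<Sum>n. y ^ n /\<^sub>R fact n)" by (simp add: exp_def)
  also have "\<dots> = (\<Sum>n. y ^ Suc n /\<^sub>R fact (Suc n)) + 1"
    using suminf_split_head[OF summable_exp_generic[of y]] by simp
  also have "(\<Sum>n. y ^ Suc n /\<^sub>R fact (Suc n)) = (\<Sum>n. y * ((1 / fact (Suc n)) * y ^ n))"
    by (simp add: divide_inverse mult_ac)
  also have "\<dots> = y * exp_quotient y"
    unfolding exp_quotient_def by (rule suminf_mult[OF summable_exp_quotient])
  finally show ?thesis by simp
qed

lemma exp_quotient_pos: "exp_quotient y > 0"
proof (cases "y = 0")
  case True
  then show ?thesis using powser_zero[of "\<lambda>n. 1 / fact (Suc n) :: real"] by (simp add: exp_quotient_def)
next
  case False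
  then have "exp_quotient y = (exp y - 1) / y" using mult_exp_quotient[of y] by (simp add: field_simps)
  then show ?thesis using False by (cases "y > 0") (auto simp: zero_less_divide_iff)
qed

lemma exp_quotient_C1:
  obtains q where "\<And>y. (exp_quotient has_real_derivative q y) (at y)" "\<And>y. isCont q y"
proof -
  define c where "c n = (1 / fact (Suc n) :: real)" for n
  have S: "summable (\<lambda>n. c n * y ^ n)" for y unfolding c_def by (rule summable_exp_quotient)
  have S': "summable (\<lambda>n. diffs c n * y ^ n)" for y
    by (rule termdiff_converges_all) (rule S)
  show ?thesis
  proof
    show "(exp_quotient has_real_derivative (\<Sum>n. diffs c n * y ^ n)) (at y)" for y
      using termdiffs_strong_converges_everywhere[OF S, of y]
      unfolding exp_quotient_def[abs_def] c_def .
    show "isCont (\<lambda>y. \<Sum>n. diffs c n * y ^ n) y" for y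
      by (rule DERIV_isCont[OF termdiffs_strong_converges_everywhere[OF S']])
  qed
qed

text \<open>The logarithmic mean \<open>(u - v) / (ln u - ln v)\<close> of \<open>u = exp a\<close> and \<open>v = exp b\<close>, in a form without
  case distinction at \<open>a = b\<close>.\<close>

definition log_mean_exp :: "real \<Rightarrow> real \<Rightarrow> real" where
  "log_mean_exp a b = exp b * exp_quotient (a - b)"

lemma mult_log_mean_exp: "(a - b) * log_mean_exp a b = exp a - exp b"
proof -
  have "(a - b) * log_mean_exp a b = exp b * (exp (a - b) - 1)"
    unfolding log_mean_exp_def mult_exp_quotient[symmetric] by (simp add: mult_ac)
  then show ?thesis by (simp add: right_diff_distrib flip: exp_add)
qed

lemma log_mean_exp_commute: "log_mean_exp a b = log_mean_exp b a"
proof (cases "a = b")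
  case False
  have "(a - b) * log_mean_exp a b = (a - b) * log_mean_exp b a"
    using mult_log_mean_exp[of a b] mult_log_mean_exp[of b a] by (simp add: algebra_simps)
  then show ?thesis using False by simp
qed simp

lemma log_mean_exp_pos: "log_mean_exp a b > 0"
  by (simp add: log_mean_exp_def exp_quotient_pos)

text \<open>The weighted graph Laplacian with edge weights \<open>c\<close>, plus the matrix all of whose entries are \<open>1\<close>.
  The Laplacian annihilates the constant vectors; the added matrix vanishes on the tangent space and
  removes this kernel.\<close>

definition conductance_matrix :: "('n \<Rightarrow> 'n \<Rightarrow> real) \<Rightarrow> real^'n^'n" where
  "conductance_matrix c = (\<chi> i j. (if i = j then (\<Sum>k\<in>UNIV. c i k) else 0) - c i j + 1)"

lemma conductance_matrix_mult:
  "(conductance_matrix c *v a) $ i = (\<Sum>j\<in>UNIV. c i j * (a $ i - a $ j)) + (\<Sum>j\<in>UNIV. a $ j)"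
  by (simp add: conductance_matrix_def matrix_vector_mult_def algebra_simps sum.distrib
      sum_subtractf mult_delta_right mult_delta_left sum_distrib_left sum_distrib_right)

lemma conductance_matrix_quadratic_form:
  assumes sym: "\<And>i j. c i j = c j i"
  shows "a \<bullet> (conductance_matrix c *v a)
    = (\<Sum>i\<in>UNIV. \<Sum>j\<in>UNIV. c i j * (a $ i - a $ j)\<^sup>2) / 2 + (\<Sum>j\<in>UNIV. a $ j)\<^sup>2"
proof -
  have "(\<Sum>i\<in>UNIV. \<Sum>j\<in>UNIV. c i j * (a $ i - a $ j)\<^sup>2)
      = (\<Sum>i\<in>UNIV. \<Sum>j\<in>UNIV. a $ i * (c i j * (a $ i - a $ j)))
      + (\<Sum>i\<in>UNIV. \<Sum>j\<in>UNIV. a $ j * (c i j * (a $ j - a $ i)))"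
    by (simp add: power2_eq_square algebra_simps flip: sum.distrib)
  also have "(\<Sum>i\<in>UNIV. \<Sum>j\<in>UNIV. a $ j * (c i j * (a $ j - a $ i)))
      = (\<Sum>i\<in>UNIV. \<Sum>j\<in>UNIV. a $ i * (c i j * (a $ i - a $ j)))"
    by (subst sum.swap) (simp add: sym)
  finally show ?thesis
    by (simp add: inner_vec_def conductance_matrix_mult distrib_left sum.distrib
        sum_distrib_left[symmetric] sum_distrib_right[symmetric] power2_eq_square)
qed

text \<open>If the quadratic form vanishes at \<open>a\<close>, then the Dirichlet form forces \<open>a\<close> to be constant along
  edges, hence constant by connectedness, and the square of the sum forces the constant to be zero.
  The diagonal weights cancel in the Laplacian, so that they may be negative.\<close>

lemma conductance_matrix_positive_definite:
  fixes c :: "'n::finite \<Rightarrow> 'n \<Rightarrow> real"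
  assumes sym: "\<And>i j. c i j = c j i" and nonneg: "\<And>i j. i \<noteq> j \<Longrightarrow> c i j \<ge> 0"
    and conn: "\<And>i j. (i, j) \<in> {(k, l). k \<noteq> l \<and> c k l > 0}\<^sup>*" and a: "a \<noteq> 0"
  shows "a \<bullet> (conductance_matrix c *v a) > 0"
proof (rule ccontr)
  assume neg: "\<not> ?thesis"
  have summand_nonneg: "c i j * (a $ i - a $ j)\<^sup>2 \<ge> 0" for i j
    using nonneg[of i j] by (cases "i = j") auto
  then have form: "(\<Sum>i\<in>UNIV. \<Sum>j\<in>UNIV. c i j * (a $ i - a $ j)\<^sup>2) \<ge> 0"
    by (intro sum_nonneg summand_nonneg)
  with neg have *: "(\<Sum>i\<in>UNIV. \<Sum>j\<in>UNIV. c i j * (a $ i - a $ j)\<^sup>2) = 0" "(\<Sum>j\<in>UNIV. a $ j)\<^sup>2 = 0"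
    unfolding conductance_matrix_quadratic_form[OF sym]
    using zero_le_power2[of "\<Sum>j\<in>UNIV. a $ j"] by linarith+
  have zero: "c i j * (a $ i - a $ j)\<^sup>2 = 0" for i j
    using *(1) summand_nonneg by (simp add: sum_nonneg_eq_0_iff sum_nonneg)
  have "a $ i = a $ j" for i j
    using conn[of i j]
  proof (induction rule: rtrancl_induct)
    case (step k l)
    then show ?case using zero[of k l] by auto
  qed simp
  then have "(\<Sum>j\<in>UNIV. a $ j) = (\<Sum>j\<in>(UNIV::'n set). a $ i)" for i by (intro sum.cong) auto
  then have "a $ i = 0" for i using *(2) by simp
  then show False using a by (simp add: vec_eq_iff)
qed

lemma conductance_matrix_symmetric:
  assumes "\<And>i j. c i j = c j i"
  shows "x \<bullet> (conductance_matrix c *v y) = y \<bullet> (conductance_matrix c *v x)"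
proof -
  have "transpose (conductance_matrix c) = conductance_matrix c"
    using assms by (auto simp: conductance_matrix_def transpose_def vec_eq_iff)
  then show ?thesis
    by (metis dot_lmul_matrix inner_commute transpose_matrix_vector)
qed

text \<open>The solution of a linear system in a form that exhibits its dependence on the matrix as a quotient
  of polynomials in the entries.\<close>

definition cramer_solve :: "real^'n^'n \<Rightarrow> real^'n \<Rightarrow> real^'n" where
  "cramer_solve A v = (\<chi> k. det (\<chi> i j. if j = k then v $ i else A $ i $ j) / det A)"

lemma cramer_solve_iff: "det A \<noteq> 0 \<Longrightarrow> A *v x = v \<longleftrightarrow> x = cramer_solve A v"
  unfolding cramer_solve_def by (rule cramer)

lemma C1_cramer_solve:
  fixes A :: "real^'n \<Rightarrow> real^'n^'n"
  assumes A: "\<And>i j. C_k 1 (\<lambda>\<mu>. A \<mu> $ i $ j)" and nz: "\<And>\<mu>. \<mu> \<in> pos_dists \<Longrightarrow> det (A \<mu>) \<noteq> 0"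
  shows "C_k 1 (\<lambda>\<mu>. cramer_solve (A \<mu>) v $ k)"
proof -
  have "C_k 1 (\<lambda>\<mu>. det (\<chi> i j. if j = k then v $ i else A \<mu> $ i $ j))"
  proof (rule C_k_det)
    show "C_k 1 (\<lambda>\<mu>. (\<chi> i j. if j = k then v $ i else A \<mu> $ i $ j) $ i $ j)" for i j
      using A by (cases "j = k") (simp_all add: C_k_const del: One_nat_def)
  qed
  then show ?thesis
    unfolding cramer_solve_def vec_lambda_beta by (rule C1_divide[OF _ C_k_det[OF A] nz])
qed

text \<open>The metric is \<open>g\<^sub>\<mu>(u, v) = v \<bullet> A\<^sub>\<mu>\<^sup>-\<^sup>1 u\<close> for the conductance matrix \<open>A\<^sub>\<mu>\<close> with weights
  \<open>\<Lambda>\<^sub>i\<^sub>j \<pi>\<^sub>i Q\<^sub>i\<^sub>j\<close>, which are symmetric by detailed balance. With \<open>\<alpha>\<^sub>i = ln (\<mu>\<^sub>i / \<pi>\<^sub>i)\<close> the logarithmic mean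
  gives \<open>\<Lambda>\<^sub>i\<^sub>j (\<alpha>\<^sub>i - \<alpha>\<^sub>j) = \<mu>\<^sub>i / \<pi>\<^sub>i - \<mu>\<^sub>j / \<pi>\<^sub>j\<close>, and therefore \<open>A\<^sub>\<mu>\<close> maps the centred version of \<open>- \<alpha>\<close> to
  \<open>\<mu>Q\<close>. On tangent vectors \<open>\<alpha>\<close> is the differential of the entropy.\<close>

lemma time_reversible_imp_entropy_gradient_flow:
  fixes Q :: "real^'n^'n"
  assumes gen: "generator Q" and irr: "irreducible_chain Q" and \<pi>: "\<And>i. \<pi> $ i > 0"
    and rev: "time_reversible Q \<pi>"
  shows "\<exists>g. C1_riemannian_metric g \<and> semigroup_is_gradient_flow Q (relative_entropy \<pi>) g"
proof -
  define \<alpha> :: "real^'n \<Rightarrow> real^'n" where "\<alpha> \<mu> = (\<chi> i. ln (\<mu> $ i / \<pi> $ i))" for \<mu>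
  define c where "c \<mu> i j = log_mean_exp (\<alpha> \<mu> $ i) (\<alpha> \<mu> $ j) * (\<pi> $ i * Q $ i $ j)" for \<mu> i j
  define A where "A \<mu> = conductance_matrix (c \<mu>)" for \<mu>
  define g where "g \<mu> u v = v \<bullet> cramer_solve (A \<mu>) u" for \<mu> u v
  have pos: "\<mu> $ i > 0" if "\<mu> \<in> pos_dists" for \<mu> i using that by (simp add: pos_dists_def)
  have exp\<alpha>: "exp (\<alpha> \<mu> $ i) = \<mu> $ i / \<pi> $ i" if "\<mu> \<in> pos_dists" for \<mu> i
    using pos[OF that, of i] \<pi>[of i] by (simp add: \<alpha>_def)
  have sym: "c \<mu> i j = c \<mu> j i" for \<mu> i j
    using rev log_mean_exp_commute[of "\<alpha> \<mu> $ i" "\<alpha> \<mu> $ j"] by (simp add: c_def time_reversible_def)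
  have nonneg: "c \<mu> i j \<ge> 0" if "i \<noteq> j" for \<mu> i j
    using gen \<pi>[of i] log_mean_exp_pos[of "\<alpha> \<mu> $ i" "\<alpha> \<mu> $ j"] that by (simp add: c_def generator_def)
  have "{(k, l). k \<noteq> l \<and> c \<mu> k l > 0} = {(k, l). k \<noteq> l \<and> Q $ k $ l > 0}" for \<mu>
    using \<pi> log_mean_exp_pos by (auto simp: c_def zero_less_mult_iff not_less_iff_gr_or_eq dest: less_asym)
  then have conn: "(i, j) \<in> {(k, l). k \<noteq> l \<and> c \<mu> k l > 0}\<^sup>*" for \<mu> i j
    using irr by (simp add: irreducible_chain_def)
  have A_pos: "a \<bullet> (A \<mu> *v a) > 0" if "a \<noteq> 0" for \<mu> a
    unfolding A_def by (rule conductance_matrix_positive_definite[OF sym nonneg conn that])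
  have A_sym: "x \<bullet> (A \<mu> *v y) = y \<bullet> (A \<mu> *v x)" for \<mu> x y
    unfolding A_def by (rule conductance_matrix_symmetric[OF sym])
  have "A \<mu> *v a = 0 \<Longrightarrow> a = 0" for \<mu> a
    using A_pos[of a \<mu>] by (cases "a = 0") auto
  then have det: "det (A \<mu>) \<noteq> 0" for \<mu>
    using matrix_left_invertible_ker invertible_left_inverse invertible_det_nz by metis
  define N where "N \<mu> v = cramer_solve (A \<mu>) v" for \<mu> v
  have N: "A \<mu> *v x = v \<longleftrightarrow> x = N \<mu> v" for \<mu> x v
    unfolding N_def by (rule cramer_solve_iff[OF det])
  have AN: "A \<mu> *v N \<mu> v = v" for \<mu> v by (simp add: N)
  have N_add: "N \<mu> (u + v) = N \<mu> u + N \<mu> v" for \<mu> u v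
    by (rule N[THEN iffD1, symmetric]) (simp add: matrix_vector_right_distrib AN)
  have N_scale: "N \<mu> (r *\<^sub>R v) = r *\<^sub>R N \<mu> v" for \<mu> v r
    by (rule N[THEN iffD1, symmetric]) (simp add: matrix_vector_mult_scaleR AN)
  have gN: "g \<mu> u v = v \<bullet> N \<mu> u" for \<mu> u v by (simp add: g_def N_def)
  have ip: "inner_product_on_tangent (g \<mu>)" for \<mu>
    unfolding inner_product_on_tangent_def
  proof (intro conjI ballI allI impI)
    show "g \<mu> u v = g \<mu> v u" for u v
      using A_sym[of "N \<mu> v" \<mu> "N \<mu> u"] by (simp add: gN AN inner_commute)
    show "g \<mu> u u > 0" if "u \<noteq> 0" for u
    proof -
      have "N \<mu> u \<noteq> 0" using that AN[of \<mu> u] by auto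
      from A_pos[OF this, of \<mu>] show ?thesis by (simp add: gN AN inner_commute)
    qed
  qed (simp_all add: gN N_add N_scale inner_add_right)
  have C1\<alpha>: "C_k 1 (\<lambda>\<mu>. \<alpha> \<mu> $ i)" for i
    unfolding \<alpha>_def vec_lambda_beta
  proof (rule C1_compose[where h = ln and h' = inverse])
    show "C_k 1 (\<lambda>\<mu>. \<mu> $ i / \<pi> $ i)"
      by (rule C_k_linear) (auto intro!: linearI simp: add_divide_distrib)
    show "(ln has_real_derivative inverse (\<mu> $ i / \<pi> $ i)) (at (\<mu> $ i / \<pi> $ i))"
      "isCont inverse (\<mu> $ i / \<pi> $ i)" if "\<mu> \<in> pos_dists" for \<mu>
      using pos[OF that, of i] \<pi>[of i] DERIV_ln[of "\<mu> $ i / \<pi> $ i"]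
      by (auto intro!: continuous_intros)
  qed
  obtain q where q: "\<And>y. (exp_quotient has_real_derivative q y) (at y)" "\<And>y. isCont q y"
    by (fact exp_quotient_C1)
  have C1c: "C_k 1 (\<lambda>\<mu>. c \<mu> i j)" for i j
  proof -
    have "C_k 1 (\<lambda>\<mu>. \<alpha> \<mu> $ i - \<alpha> \<mu> $ j)"
      using C_k_add[OF C1\<alpha> C_k_uminus[OF C1\<alpha>]] by simp
    then have "C_k 1 (\<lambda>\<mu>. exp_quotient (\<alpha> \<mu> $ i - \<alpha> \<mu> $ j))"
      by (rule C1_compose[where h' = q]) (rule q)+
    moreover have "C_k 1 (\<lambda>\<mu>. exp (\<alpha> \<mu> $ j))"
      by (rule C1_compose[where h = exp and h' = exp, OF C1\<alpha>]) (rule DERIV_exp isCont_exp)+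
    ultimately show ?thesis
      unfolding c_def log_mean_exp_def by (intro C_k_mult C_k_const)
  qed
  have "C_k 1 (\<lambda>\<mu>. A \<mu> $ i $ j)" for i j
  proof -
    have "C_k 1 (\<lambda>\<mu>. if i = j then \<Sum>k\<in>UNIV. c \<mu> i k else 0)"
      using C_k_sum[of UNIV 1 "\<lambda>k \<mu>. c \<mu> i k", OF C1c] C_k_const[of 1 0] by (cases "i = j") simp_all
    from C_k_add[OF C_k_add[OF this C_k_uminus[OF C1c]] C_k_const]
    show ?thesis by (simp add: A_def conductance_matrix_def)
  qed
  then have "C_k 1 (\<lambda>\<mu>. g \<mu> v w)" for v w
    unfolding g_def inner_vec_def inner_real_def
    by (intro C_k_sum C_k_mult C_k_const C1_cramer_solve det)
  then have "C1_riemannian_metric g" using ip by (simp add: C1_riemannian_metric_def)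
  moreover have "semigroup_is_gradient_flow Q (relative_entropy \<pi>) g"
    unfolding semigroup_is_gradient_flow_iff[OF gen]
  proof (intro ballI conjI)
    fix \<mu> :: "real^'n" assume \<mu>: "\<mu> \<in> pos_dists"
    note dH = relative_entropy_has_derivative[OF \<mu> \<pi>]
    show "relative_entropy \<pi> differentiable (at \<mu> within pos_dists)"
      using dH by (auto simp: differentiable_def)
    fix v :: "real^'n" assume v: "v \<in> tangent"
    (* centring makes the rank-one part of the conductance matrix vanish on a *)
    define m where "m = (\<Sum>i\<in>UNIV. \<alpha> \<mu> $ i) / CARD('n)"
    define a :: "real^'n" where "a = (\<chi> i. m - \<alpha> \<mu> $ i)"
    have "A \<mu> *v a = \<mu> v* Q"
    proof (rule vec_eq_iff[THEN iffD2], rule allI)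
      fix i
      have "(\<Sum>j\<in>UNIV. a $ j) = 0" by (simp add: a_def sum_subtractf m_def)
      moreover have "c \<mu> i j * (a $ i - a $ j) = \<mu> $ j * Q $ j $ i - \<mu> $ i * Q $ i $ j" for j
      proof -
        have "c \<mu> i j * (a $ i - a $ j)
            = - ((\<alpha> \<mu> $ i - \<alpha> \<mu> $ j) * log_mean_exp (\<alpha> \<mu> $ i) (\<alpha> \<mu> $ j)) * (\<pi> $ i * Q $ i $ j)"
          by (simp add: c_def a_def algebra_simps)
        also have "\<dots> = \<mu> $ j / \<pi> $ j * (\<pi> $ i * Q $ i $ j) - \<mu> $ i / \<pi> $ i * (\<pi> $ i * Q $ i $ j)"
          unfolding mult_log_mean_exp exp\<alpha>[OF \<mu>] by (simp add: algebra_simps)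
        also have "\<pi> $ i * Q $ i $ j = \<pi> $ j * Q $ j $ i" using rev by (simp add: time_reversible_def)
        finally show ?thesis
          using rev \<pi>[of i] \<pi>[of j] by (simp add: time_reversible_def)
      qed
      ultimately have "(A \<mu> *v a) $ i = (\<Sum>j\<in>UNIV. \<mu> $ j * Q $ j $ i) - \<mu> $ i * (\<Sum>j\<in>UNIV. Q $ i $ j)"
        by (simp add: A_def conductance_matrix_mult sum_subtractf sum_distrib_left)
      then show "(A \<mu> *v a) $ i = (\<mu> v* Q) $ i"
        by (simp add: generator_row_sum[OF gen] vector_matrix_mult_component)
    qed
    then have "N \<mu> (\<mu> v* Q) = a" unfolding N by simp
    then have "g \<mu> (\<mu> v* Q) v = (\<Sum>i\<in>UNIV. v $ i * (m - \<alpha> \<mu> $ i))"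
      by (simp add: gN inner_vec_def a_def)
    also have "\<dots> = - (\<Sum>i\<in>UNIV. v $ i * (ln (\<mu> $ i / \<pi> $ i) + 1))"
      using v by (simp add: \<alpha>_def tangent_def right_diff_distrib distrib_left sum.distrib sum_subtractf
          flip: sum_distrib_right)
    also have "\<dots> = - differential (relative_entropy \<pi>) \<mu> v"
      by (simp add: differential_eq[OF dH \<mu> v])
    finally show "g \<mu> (\<mu> v* Q) v = - differential (relative_entropy \<pi>) \<mu> v" .
  qed
  ultimately show ?thesis by blast
qed

theorem theorem1p4:
  fixes Q :: "real^'n^'n" and \<pi> :: "real^'n"
  assumes "generator Q" and "irreducible_chain Q" and "stationary_distribution Q \<pi>"
  shows "(time_reversible Q \<pi> \<longleftrightarrow>
           (\<exists>g. C1_riemannian_metric g \<and> semigroup_is_gradient_flow Q (relative_entropy \<pi>) g)) \<and>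
         (real_diagonalisable Q \<longleftrightarrow>
           (\<exists>g F. C1_riemannian_metric g \<and> C_k 2 F \<and> semigroup_is_gradient_flow Q F g))"
proof -
  have \<pi>: "\<pi> \<in> pos_dists" by (rule stationary_distribution_in_pos_dists[OF assms])
  have \<pi>Q: "\<pi> v* Q = 0" using assms(3) by (simp add: stationary_distribution_def)
  show ?thesis
    using time_reversible_imp_entropy_gradient_flow[OF assms(1,2) stationary_distribution_positive[OF assms]]
      entropy_gradient_flow_imp_time_reversible[OF assms(1) _ _ \<pi> \<pi>Q]
      real_diagonalisable_imp_gradient_flow[OF assms(1)]
      gradient_flow_imp_real_diagonalisable[OF assms(1) _ _ \<pi> \<pi>Q]
    by blast
qed

end
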